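(* Within the pseudovariety $\mathsf M$ of all finite monoids, the pseudoidentity $x^{\omega+1}=x^\omega$ is h-strong.
   Context: $\mathsf M$ is the pseudovariety of finite monoids (signature: multiplication and $1$); $\Omega_A\mathsf M$ is the free profinite monoid on a finite set $A$. In a profinite monoid $x^\omega=\lim x^{n!}$ and $x^{\omega+1}=x^\omega x$. An $\mathsf M$-pseudoidentity is $u=v$ with $u,v\in\Omega_B\mathsf M$, $B$ finite; it holds in a finite monoid $T$ if both sides agree under every continuous homomorphism $\Omega_B\mathsf M\to T$; $[\![\Sigma]\!]$ is the class of finite monoids satisfying $\Sigma$. Provability: for finite $A$, $\Sigma_0\subseteq\Omega_A\mathsf M\times\Omega_A\mathsf M$ is the set of pairs $(\mathbf t(\varphi(u),w_1,\dots,w_n),\mathbf t(\varphi(v),w_1,\dots,w_n))$ with $u=v$ or $v=u$ in $\Sigma$ ($u,v\in\Omega_B\mathsf M$), $\varphi:\Omega_B\mathsf M\to\Omega_A\mathsf M$ a continuous homomorphism, $\mathbf t$ a monoid term, $w_i\in\Omega_A\mathsf M$; $\Sigma_{2\alpha+1}$ is the transitive closure of $\Sigma_{2\alpha}$, $\Sigma_{2\alpha+2}$ the topological closure of $\Sigma_{2\alpha+1}$, unions at limit ordinals; $u=v$ is provable from $\Sigma$ if $(u,v)\in\bigcup_\alpha\Sigma_\alpha$. A set $\Sigma$ (or a single pseudoidentity, viewed as a one-element set) is h-strong within $\mathsf M$ if every $\mathsf M$-pseudoidentity valid in $[\![\Sigma]\!]$ is provable from $\Sigma$. *)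

theory Defs
  imports "HOL-Analysis.Analysis"
begin

type_synonym fm = "nat \<times> (nat \<Rightarrow> nat \<Rightarrow> nat) \<times> nat"

definition fm_car :: "fm \<Rightarrow> nat set" where "fm_car T = {..<fst T}"
definition fm_mul :: "fm \<Rightarrow> nat \<Rightarrow> nat \<Rightarrow> nat" where "fm_mul T = fst (snd T)"
definition fm_one :: "fm \<Rightarrow> nat" where "fm_one T = snd (snd T)"

definition finite_monoid :: "fm \<Rightarrow> bool" where
  "finite_monoid T \<longleftrightarrow>
     fm_one T \<in> fm_car T \<and>
     (\<forall>x\<in>fm_car T. \<forall>y\<in>fm_car T. fm_mul T x y \<in> fm_car T) \<and>
     (\<forall>x\<in>fm_car T. \<forall>y\<in>fm_car T. \<forall>z\<in>fm_car T.
        fm_mul T (fm_mul T x y) z = fm_mul T x (fm_mul T y z)) \<and>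
     (\<forall>x\<in>fm_car T. fm_mul T (fm_one T) x = x \<and> fm_mul T x (fm_one T) = x)"

definition fm_hom :: "(nat \<Rightarrow> nat) \<Rightarrow> fm \<Rightarrow> fm \<Rightarrow> bool" where
  "fm_hom h S T \<longleftrightarrow>
     (\<forall>x\<in>fm_car S. h x \<in> fm_car T) \<and>
     (\<forall>x\<in>fm_car S. \<forall>y\<in>fm_car S. h (fm_mul S x y) = fm_mul T (h x) (h y)) \<and>
     h (fm_one S) = fm_one T"

section \<open>The free profinite monoid as the monoid of implicit operations\<close>

type_synonym tst = "fm \<times> (nat \<Rightarrow> nat)"
type_synonym pt = "tst \<Rightarrow> nat"

definition tests :: "nat set \<Rightarrow> tst set" where
  "tests A = {(T, f). finite_monoid T \<and> f \<in> A \<rightarrow>\<^sub>E fm_car T}"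

definition Omega :: "nat set \<Rightarrow> pt set" where
  "Omega A = {u \<in> extensional (tests A).
     (\<forall>(T, f)\<in>tests A. u (T, f) \<in> fm_car T) \<and>
     (\<forall>T f T' h. (T, f) \<in> tests A \<and> finite_monoid T' \<and> fm_hom h T T' \<longrightarrow>
        h (u (T, f)) = u (T', restrict (h \<circ> f) A))}"

definition OmTop :: "nat set \<Rightarrow> pt topology" where
  "OmTop A = subtopology (product_topology (\<lambda>_. discrete_topology (UNIV :: nat set)) (tests A)) (Omega A)"

definition om_mul :: "nat set \<Rightarrow> pt \<Rightarrow> pt \<Rightarrow> pt" where
  "om_mul A u v = restrict (\<lambda>p. fm_mul (fst p) (u p) (v p)) (tests A)"

definition om_one :: "nat set \<Rightarrow> pt" where
  "om_one A = restrict (\<lambda>p. fm_one (fst p)) (tests A)"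

definition om_gen :: "nat set \<Rightarrow> nat \<Rightarrow> pt" where
  "om_gen A a = restrict (\<lambda>p. snd p a) (tests A)"

definition om_pow :: "nat set \<Rightarrow> pt \<Rightarrow> nat \<Rightarrow> pt" where
  "om_pow A u n = (om_mul A u ^^ n) (om_one A)"

definition om_omega :: "nat set \<Rightarrow> pt \<Rightarrow> pt" where
  "om_omega A u = (THE l. limitin (OmTop A) (\<lambda>n. om_pow A u (fact n)) l sequentially)"

definition om_omega_plus1 :: "nat set \<Rightarrow> pt \<Rightarrow> pt" where
  "om_omega_plus1 A u = om_mul A (om_omega A u) u"

definition cont_hom_om :: "nat set \<Rightarrow> nat set \<Rightarrow> (pt \<Rightarrow> pt) \<Rightarrow> bool" where
  "cont_hom_om B A \<phi> \<longleftrightarrow>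
     continuous_map (OmTop B) (OmTop A) \<phi> \<and>
     (\<forall>u\<in>Omega B. \<forall>v\<in>Omega B. \<phi> (om_mul B u v) = om_mul A (\<phi> u) (\<phi> v)) \<and>
     \<phi> (om_one B) = om_one A"

definition cont_hom_fm :: "nat set \<Rightarrow> fm \<Rightarrow> (pt \<Rightarrow> nat) \<Rightarrow> bool" where
  "cont_hom_fm B T \<psi> \<longleftrightarrow>
     continuous_map (OmTop B) (discrete_topology (fm_car T)) \<psi> \<and>
     (\<forall>u\<in>Omega B. \<forall>v\<in>Omega B. \<psi> (om_mul B u v) = fm_mul T (\<psi> u) (\<psi> v)) \<and>
     \<psi> (om_one B) = fm_one T"

type_synonym pid = "nat set \<times> pt \<times> pt"

definition pseudoidentity :: "pid \<Rightarrow> bool" where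
  "pseudoidentity e \<longleftrightarrow> (case e of (B, u, v) \<Rightarrow> finite B \<and> u \<in> Omega B \<and> v \<in> Omega B)"

definition holds_in :: "fm \<Rightarrow> pid \<Rightarrow> bool" where
  "holds_in T e \<longleftrightarrow> (case e of (B, u, v) \<Rightarrow> \<forall>\<psi>. cont_hom_fm B T \<psi> \<longrightarrow> \<psi> u = \<psi> v)"

definition models :: "pid set \<Rightarrow> fm set" where
  "models \<Sigma> = {T. finite_monoid T \<and> (\<forall>e\<in>\<Sigma>. holds_in T e)}"

text \<open>Monoid terms, represented by words over variable indices; variable 0 is the
  distinguished one replaced by phi(u) resp. phi(v).\<close>
definition term_eval :: "nat set \<Rightarrow> nat list \<Rightarrow> (nat \<Rightarrow> pt) \<Rightarrow> pt" where
  "term_eval A t env = foldr (\<lambda>i acc. om_mul A (env i) acc) t (om_one A)"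

definition Sigma0 :: "pid set \<Rightarrow> nat set \<Rightarrow> (pt \<times> pt) set" where
  "Sigma0 \<Sigma> A = {(term_eval A t (env(0 := \<phi> u)), term_eval A t (env(0 := \<phi> v))) | t env \<phi> B u v.
      ((B, u, v) \<in> \<Sigma> \<or> (B, v, u) \<in> \<Sigma>) \<and> cont_hom_om B A \<phi> \<and> (\<forall>i. env i \<in> Omega A)}"

lemma closure_of_mono_mem [mono]:
  "P \<le> Q \<Longrightarrow> y \<in> X closure_of {x. P x} \<longrightarrow> y \<in> X closure_of {x. Q x}"
  by (metis (mono_tags, lifting) Collect_mono closure_of_mono le_boolD le_funD subsetD)

text \<open>The union of the transfinite sequence Sigma_alpha equals the least relation
  containing Sigma_0 closed under composition and topological closure.\<close>
inductive_set provable :: "pid set \<Rightarrow> nat set \<Rightarrow> (pt \<times> pt) set"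
  for \<Sigma> :: "pid set" and A :: "nat set" where
  base: "p \<in> Sigma0 \<Sigma> A \<Longrightarrow> p \<in> provable \<Sigma> A"
| trans: "(u, v) \<in> provable \<Sigma> A \<Longrightarrow> (v, w) \<in> provable \<Sigma> A \<Longrightarrow> (u, w) \<in> provable \<Sigma> A"
| closure: "p \<in> (prod_topology (OmTop A) (OmTop A)) closure_of (provable \<Sigma> A) \<Longrightarrow> p \<in> provable \<Sigma> A"

definition h_strong :: "pid set \<Rightarrow> bool" where
  "h_strong \<Sigma> \<longleftrightarrow>
     (\<forall>B u v. pseudoidentity (B, u, v) \<and> (\<forall>T\<in>models \<Sigma>. holds_in T (B, u, v))
        \<longrightarrow> (u, v) \<in> provable \<Sigma> B)"

end

theory Submission
  imports Defs
begin

text \<open>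
  Provability is a closed congruence on the compact monoid of implicit operations. Hence it
  suffices to find, for \<open>u = v\<close> valid in all finite aperiodic monoids and a finite monoid \<open>T\<close>
  with an assignment of the letters, a provable pair with the same values in \<open>T\<close> as \<open>(u, v)\<close>.
  Call a subset of \<open>T\<close> good if its elements are values of provably equal implicit
  operations. Good sets are closed under products, and if \<open>X\<close> is good then so is
  \<open>X\<^sup>n \<union> X\<^sup>n\<^sup>+\<^sup>1\<close> for some \<open>n\<close>; this is the only place where \<open>x\<^sup>\<omega>\<^sup>+\<^sup>1 = x\<^sup>\<omega>\<close> is used. As in
  Henckell's theorem on aperiodic pointlike sets, this closure property yields a finite aperiodic
  monoid \<open>N\<close> such that words with equal values in \<open>N\<close> have their values in \<open>T\<close> in a common
  good set. Approximating \<open>u\<close> and \<open>v\<close> by words in \<open>T\<close> and \<open>N\<close> simultaneously concludes the proof.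
\<close>

section \<open>Aperiodic colourings of words\<close>

text \<open>Words act on the subsets of \<open>T\<close>: a letter multiplies from the right by the
  singleton of its value. If \<open>T\<close> contains nontrivial groups, no aperiodic monoid can
  recognise this action, so it is only bounded from above. A colouring \<open>F\<close> sends each
  word to right multiplication by a good set containing its value, and \<open>N\<close> is the
  syntactic monoid of \<open>F\<close>. If all letters permute the states, one bound serves all
  words; otherwise a letter with smaller image cuts the words, and \<open>F\<close> is glued from
  colourings over a smaller alphabet and over a smaller set of states. The union of two consecutive
  powers is what absorbs groups: composed with a suitable power of a permutation, it yields a bound
  above both the identity and that permutation. The union is good because, when the elements of
  \<open>X\<close> are values of operations provably equal to \<open>g\<close>, a suitable power of
  \<open>X\<close> and its successor belong to \<open>g\<^sup>\<omega>\<close> and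
  \<open>g\<^sup>\<omega>g\<close>.\<close>

definition wpow :: "nat \<Rightarrow> 'a list \<Rightarrow> 'a list" where
  "wpow n x = concat (replicate n x)"

lemma wpow_simps [simp]: "wpow 0 x = []" "wpow (Suc n) x = x @ wpow n x"
  by (simp_all add: wpow_def)

lemma wpow_in_lists [simp]: "x \<in> lists A \<Longrightarrow> wpow n x \<in> lists A"
  by (induction n) auto

lemma map_wpow: "map h (wpow n x) = wpow n (map h x)"
  by (induction n) auto

lemma set_wpow: "set (wpow n x) \<subseteq> set x"
  by (induction n) auto

lemma append_in_lists [simp]: "u \<in> lists A \<Longrightarrow> v \<in> lists A \<Longrightarrow> u @ v \<in> lists A"
  by auto

text \<open>The class of a word is represented by its function from contexts to colours, so no
  quotient has to be formed. The restriction makes contexts outside \<open>A\<close> irrelevant for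
  equality of classes.\<close>

definition syn :: "'a set \<Rightarrow> ('a list \<Rightarrow> 'b) \<Rightarrow> 'a list \<Rightarrow> 'a list \<times> 'a list \<Rightarrow> 'b" where
  "syn A F w = restrict (\<lambda>(u, v). F (u @ w @ v)) (lists A \<times> lists A)"

lemma syn_eq_iff:
  "syn A F w = syn A F w' \<longleftrightarrow> (\<forall>u\<in>lists A. \<forall>v\<in>lists A. F (u @ w @ v) = F (u @ w' @ v))"
  by (auto simp: syn_def restrict_def fun_eq_iff)

lemma synD:
  "syn A F w = syn A F w' \<Longrightarrow> u \<in> lists A \<Longrightarrow> v \<in> lists A \<Longrightarrow> F (u @ w @ v) = F (u @ w' @ v)"
  by (simp add: syn_eq_iff)

lemma syn_imp_eq: "syn A F w = syn A F w' \<Longrightarrow> F w = F w'"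
  using synD[of A F w w' "[]" "[]"] by simp

lemma syn_cong:
  assumes "syn A F w = syn A F w'" "u \<in> lists A" "v \<in> lists A"
  shows "syn A F (u @ w @ v) = syn A F (u @ w' @ v)"
  unfolding syn_eq_iff
proof (intro ballI)
  fix x y assume "x \<in> lists A" "y \<in> lists A"
  then show "F (x @ (u @ w @ v) @ y) = F (x @ (u @ w' @ v) @ y)"
    using synD[OF assms(1), of "x @ u" "v @ y"] assms(2,3) by simp
qed

text \<open>The kernel of \<^term>\<open>syn A F\<close> is the syntactic congruence of the colouring \<^term>\<open>F\<close>, so
  aperiodicity of \<^term>\<open>F\<close> means that its syntactic monoid is finite and aperiodic.\<close>

definition aperiodic_on :: "'a set \<Rightarrow> ('a list \<Rightarrow> 'b) \<Rightarrow> bool" where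
  "aperiodic_on A F \<longleftrightarrow> finite (syn A F ` lists A) \<and>
     (\<exists>n. \<forall>m\<ge>n. \<forall>x\<in>lists A. syn A F (wpow m x) = syn A F (wpow (Suc m) x))"

lemma finite_image_factor:
  assumes "finite (K ` L)" "\<And>x y. x \<in> L \<Longrightarrow> y \<in> L \<Longrightarrow> K x = K y \<Longrightarrow> G x = G y"
  shows "finite (G ` L)"
proof -
  define r where "r k = (SOME x. x \<in> L \<and> K x = k)" for k
  have r: "r (K x) \<in> L \<and> K (r (K x)) = K x" if "x \<in> L" for x
    unfolding r_def using that by (intro someI[of "\<lambda>y. y \<in> L \<and> K y = K x" x]) auto
  have "G ` L = (\<lambda>k. G (r k)) ` K ` L"
    unfolding image_image by (rule image_cong[OF refl]) (metis r assms(2))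
  then show ?thesis using assms(1) by simp
qed

text \<open>\<open>K\<close> is any convenient invariant finer than the syntactic congruence;
  finiteness and stationarity of powers pass to the coarser classes, which are never
  computed.\<close>

lemma aperiodic_onI:
  assumes "finite (K ` lists A)"
    and "\<And>w w' u v. w \<in> lists A \<Longrightarrow> w' \<in> lists A \<Longrightarrow> K w = K w' \<Longrightarrow>
           u \<in> lists A \<Longrightarrow> v \<in> lists A \<Longrightarrow> F (u @ w @ v) = F (u @ w' @ v)"
    and "\<And>m x. m \<ge> n \<Longrightarrow> x \<in> lists A \<Longrightarrow> K (wpow m x) = K (wpow (Suc m) x)"
  shows "aperiodic_on A F"
proof -
  have *: "syn A F w = syn A F w'" if "w \<in> lists A" "w' \<in> lists A" "K w = K w'" for w w'
    using assms(2)[OF that] by (auto simp: syn_eq_iff)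
  have "finite (syn A F ` lists A)"
    by (rule finite_image_factor[OF assms(1) *])
  moreover have "syn A F (wpow m x) = syn A F (wpow (Suc m) x)" if "m \<ge> n" "x \<in> lists A" for m x
    by (intro * wpow_in_lists assms(3) that)
  ultimately show ?thesis unfolding aperiodic_on_def by blast
qed

text \<open>A word is cut at the occurrences of a letter \<^term>\<open>a\<close> into \<^term>\<open>a\<close>-free segments. If \<^term>\<open>a\<close> occurs,
  then \<open>pre\<close>, \<open>mid\<close> and \<open>suf\<close> below are the first, the inner and the last segments.\<close>

fun segs :: "'a \<Rightarrow> 'a list \<Rightarrow> 'a list list" where
  "segs a [] = [[]]"
| "segs a (x # w) = (if x = a then [] # segs a w else (x # hd (segs a w)) # tl (segs a w))"

lemma segs_nonempty [simp]: "segs a w \<noteq> []"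
  by (cases w) auto

lemma segs_no: "a \<notin> set w \<Longrightarrow> segs a w = [w]"
  by (induction w) auto

lemma segs_tl: "tl (segs a w) = [] \<longleftrightarrow> a \<notin> set w"
  by (induction w) auto

lemma segs_append:
  "segs a (u @ v) = butlast (segs a u) @ [last (segs a u) @ hd (segs a v)] @ tl (segs a v)"
proof (induction u)
  case (Cons x u)
  obtain p m where pm: "segs a u = p # m" by (cases "segs a u") auto
  show ?case
    by (cases "m = []") (use Cons pm in auto)
qed simp

lemma segs_in_lists: "w \<in> lists A \<Longrightarrow> segs a w \<in> lists (lists (A - {a}))"
proof (induction w)
  case (Cons x w)
  then show ?case by (cases "segs a w") auto
qed simp

definition pre :: "'a \<Rightarrow> 'a list \<Rightarrow> 'a list" where "pre a w = hd (segs a w)"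
definition suf :: "'a \<Rightarrow> 'a list \<Rightarrow> 'a list" where "suf a w = last (segs a w)"
definition mid :: "'a \<Rightarrow> 'a list \<Rightarrow> 'a list list" where "mid a w = butlast (tl (segs a w))"

lemma segs_split:
  assumes "a \<in> set w" shows "segs a w = pre a w # mid a w @ [suf a w]"
proof -
  have "tl (segs a w) \<noteq> []" using assms segs_tl by metis
  then show ?thesis unfolding pre_def mid_def suf_def
    by (metis append_butlast_last_id last_tl list.collapse segs_nonempty)
qed

lemma split_in_lists:
  assumes "w \<in> lists A" "a \<in> set w"
  shows "pre a w \<in> lists (A - {a})" "suf a w \<in> lists (A - {a})" "mid a w \<in> lists (lists (A - {a}))"
  using segs_in_lists[OF assms(1), of a] segs_split[OF assms(2)] by auto

lemma segs_unique:
  assumes "segs a w = p # m @ [s]"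
  shows "pre a w = p" "suf a w = s" "mid a w = m"
  unfolding pre_def mid_def suf_def assms by (simp_all add: butlast_append)

lemma split_append1:
  assumes "a \<in> set u" "a \<in> set v"
  shows "pre a (u @ v) = pre a u" "suf a (u @ v) = suf a v"
    "mid a (u @ v) = mid a u @ [suf a u @ pre a v] @ mid a v"
proof -
  have "segs a (u @ v) = pre a u # (mid a u @ [suf a u @ pre a v] @ mid a v) @ [suf a v]"
    by (simp add: segs_append segs_split[OF assms(1)] segs_split[OF assms(2)] butlast_append)
  note segs_unique[OF this]
  then show "pre a (u @ v) = pre a u" "suf a (u @ v) = suf a v"
    "mid a (u @ v) = mid a u @ [suf a u @ pre a v] @ mid a v" by -
qed

lemma split_append2:
  assumes "a \<notin> set u" "a \<in> set v"
  shows "pre a (u @ v) = u @ pre a v" "suf a (u @ v) = suf a v" "mid a (u @ v) = mid a v"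
proof -
  have "segs a (u @ v) = (u @ pre a v) # mid a v @ [suf a v]"
    by (simp add: segs_append segs_no[OF assms(1)] segs_split[OF assms(2)])
  note segs_unique[OF this]
  then show "pre a (u @ v) = u @ pre a v" "suf a (u @ v) = suf a v" "mid a (u @ v) = mid a v" by -
qed

lemma split_append3:
  assumes "a \<in> set u" "a \<notin> set v"
  shows "pre a (u @ v) = pre a u" "suf a (u @ v) = suf a u @ v" "mid a (u @ v) = mid a u"
proof -
  have "segs a (u @ v) = pre a u # mid a u @ [suf a u @ v]"
    by (simp add: segs_append segs_split[OF assms(1)] segs_no[OF assms(2)] butlast_append)
  note segs_unique[OF this]
  then show "pre a (u @ v) = pre a u" "suf a (u @ v) = suf a u @ v" "mid a (u @ v) = mid a u" by -
qed

lemmas split_append = split_append1 split_append2 split_append3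

text \<open>Where two copies of \<open>x\<close> meet, their end segments merge into
  \<open>suf a x @ pre a x\<close>. After a fixed prefix, the inner segments of a power of
  \<open>x\<close> thus form a power of one fixed word of segments, with exponent one lower. This
  transfers aperiodicity from the derived alphabet.\<close>

lemma split_wpow:
  assumes "a \<in> set x"
  shows "pre a (wpow (Suc m) x) = pre a x \<and> suf a (wpow (Suc m) x) = suf a x \<and>
    mid a (wpow (Suc m) x) = mid a x @ wpow m ([suf a x @ pre a x] @ mid a x)"
proof (induction m)
  case (Suc m)
  have "a \<in> set (wpow (Suc m) x)" using assms by simp
  note s = split_append1[OF assms this]
  have eq: "wpow (Suc (Suc m)) x = x @ wpow (Suc m) x" by (rule wpow_simps)
  define z where "z = wpow (Suc m) x"
  show ?case using Suc unfolding eq s unfolding z_def[symmetric] by simp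
qed simp

lemma segs_join: "w = concat (map (\<lambda>z. z @ [a]) (butlast (segs a w))) @ last (segs a w)"
proof (induction w)
  case (Cons x w)
  obtain p m where pm: "segs a w = p # m" by (cases "segs a w") auto
  show ?case
    by (cases "m = []") (use Cons pm in auto)
qed simp

lemma split_join:
  assumes "a \<in> set w"
  shows "w = pre a w @ [a] @ concat (map (\<lambda>z. z @ [a]) (mid a w)) @ suf a w"
  using segs_join[of w a] by (simp add: segs_split[OF assms] butlast_append)

text \<open>A context changes the end segments by concatenation and the inner sequence by adding
  letters, so the classes of the three parts determine the colour in every context. When an end
  segment is completed to a new inner segment, assumption \<open>L\<close> guarantees that its
  letter depends only on its \<open>F\<^sub>1\<close>-value.\<close>

lemma aperiodic_on_glue:
  fixes F :: "'a list \<Rightarrow> 'b" and F\<^sub>1 :: "'a list \<Rightarrow> 'c" and F\<^sub>2 :: "'d list \<Rightarrow> 'e"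
  assumes ap1: "aperiodic_on (A - {a}) F\<^sub>1" and ap2: "aperiodic_on (L ` lists (A - {a})) F\<^sub>2"
    and L: "\<And>z z'. F\<^sub>1 z = F\<^sub>1 z' \<Longrightarrow> L z = L z'"
    and F1: "\<And>w. a \<notin> set w \<Longrightarrow> F w = h (F\<^sub>1 w)"
    and F2: "\<And>w. a \<in> set w \<Longrightarrow> F w = g (F\<^sub>1 (pre a w)) (F\<^sub>2 (map L (mid a w))) (F\<^sub>1 (suf a w))"
  shows "aperiodic_on A F"
proof -
  let ?B = "A - {a}" and ?A' = "L ` lists (A - {a})"
  \<comment> \<open>On \<open>a\<close>-free words \<open>pre\<close> and \<open>suf\<close> both
    return the whole word, so these words get classes of their own.\<close>
  define K where "K w = (if a \<in> set w
     then Inr (syn ?B F\<^sub>1 (pre a w), syn ?A' F\<^sub>2 (map L (mid a w)), syn ?B F\<^sub>1 (suf a w))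
     else Inl (syn ?B F\<^sub>1 w))" for w
  obtain n\<^sub>1 where n1: "\<And>m x. m \<ge> n\<^sub>1 \<Longrightarrow> x \<in> lists ?B \<Longrightarrow> syn ?B F\<^sub>1 (wpow m x) = syn ?B F\<^sub>1 (wpow (Suc m) x)"
    using ap1 unfolding aperiodic_on_def by blast
  obtain n\<^sub>2 where n2: "\<And>m x. m \<ge> n\<^sub>2 \<Longrightarrow> x \<in> lists ?A' \<Longrightarrow> syn ?A' F\<^sub>2 (wpow m x) = syn ?A' F\<^sub>2 (wpow (Suc m) x)"
    using ap2 unfolding aperiodic_on_def by blast
  have no: "w \<in> lists ?B" if "w \<in> lists A" "a \<notin> set w" for w
    using that by (auto simp: in_lists_conv_set)
  have mid_in: "map L (mid a w) \<in> lists ?A'" if "w \<in> lists A" "a \<in> set w" for w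
    using split_in_lists(3)[OF that] by (auto simp: in_lists_conv_set)
  note sil = split_in_lists(1,2)
  show ?thesis
  proof (rule aperiodic_onI)
    let ?X = "syn ?B F\<^sub>1 ` lists ?B" and ?Y = "syn ?A' F\<^sub>2 ` lists ?A'"
    have "K ` lists A \<subseteq> Inl ` ?X \<union> Inr ` (?X \<times> ?Y \<times> ?X)"
    proof
      fix k assume "k \<in> K ` lists A"
      then obtain w where w: "w \<in> lists A" "k = K w" by blast
      show "k \<in> Inl ` ?X \<union> Inr ` (?X \<times> ?Y \<times> ?X)"
      proof (cases "a \<in> set w")
        case True
        then show ?thesis using sil[OF w(1) True] mid_in[OF w(1) True] w(2)
          by (simp add: K_def)
      next
        case False
        then show ?thesis using no[OF w(1) False] w(2) by (simp add: K_def)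
      qed
    qed
    moreover have "finite ?X" "finite ?Y" using ap1 ap2 unfolding aperiodic_on_def by blast+
    ultimately show "finite (K ` lists A)"
      by (meson finite_SigmaI finite_UnI finite_imageI finite_subset)
  next
    fix w w' u v
    assume w: "w \<in> lists A" "w' \<in> lists A" and K: "K w = K w'" and u: "u \<in> lists A" and v: "v \<in> lists A"
    show "F (u @ w @ v) = F (u @ w' @ v)"
    proof (cases "a \<in> set w")
      case False
      with K have w'a: "a \<notin> set w'" and s: "syn ?B F\<^sub>1 w = syn ?B F\<^sub>1 w'"
        unfolding K_def by (auto split: if_splits)
      note s' = synD[OF s]
      show ?thesis
      proof (cases "a \<in> set u")
        case ua: True
        note su = sil[OF u ua]
        show ?thesis
        proof (cases "a \<in> set v")
          case va: True
          note sv = sil[OF v va]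
          have "L (suf a u @ w @ pre a v) = L (suf a u @ w' @ pre a v)"
            by (rule L, rule s') (use su sv in auto)
          then show ?thesis using ua va False w'a by (simp add: F2 split_append)
        next
          case va: False
          have "F\<^sub>1 (suf a u @ w @ v) = F\<^sub>1 (suf a u @ w' @ v)"
            by (rule s') (use su no[OF v va] in auto)
          then show ?thesis using ua va False w'a by (simp add: F2 split_append)
        qed
      next
        case ua: False
        note uB = no[OF u ua]
        show ?thesis
        proof (cases "a \<in> set v")
          case va: True
          note sv = sil[OF v va]
          have "F\<^sub>1 (u @ w @ pre a v) = F\<^sub>1 (u @ w' @ pre a v)"
            by (rule s') (use uB sv in auto)
          then show ?thesis using ua va False w'a by (simp add: F2 split_append)
        next
          case va: False
          have "F\<^sub>1 (u @ w @ v) = F\<^sub>1 (u @ w' @ v)"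
            by (rule s') (use uB no[OF v va] in auto)
          then show ?thesis using ua va False w'a by (simp add: F1)
        qed
      qed
    next
      case wa: True
      with K have w'a: "a \<in> set w'" and sp: "syn ?B F\<^sub>1 (pre a w) = syn ?B F\<^sub>1 (pre a w')"
        and sm: "syn ?A' F\<^sub>2 (map L (mid a w)) = syn ?A' F\<^sub>2 (map L (mid a w'))"
        and ss: "syn ?B F\<^sub>1 (suf a w) = syn ?B F\<^sub>1 (suf a w')"
        unfolding K_def by (auto split: if_splits)
      have p: "F\<^sub>1 (x @ pre a w) = F\<^sub>1 (x @ pre a w')" if "x \<in> lists ?B" for x
        using synD[OF sp that, of "[]"] by simp
      have s: "F\<^sub>1 (suf a w @ x) = F\<^sub>1 (suf a w' @ x)" if "x \<in> lists ?B" for x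
        using synD[OF ss _ that, of "[]"] by simp
      note m = synD[OF sm]
      have p0: "F\<^sub>1 (pre a w) = F\<^sub>1 (pre a w')" and s0: "F\<^sub>1 (suf a w) = F\<^sub>1 (suf a w')"
        using sp ss by (auto dest: syn_imp_eq)
      \<comment> \<open>These are the letters that the two contexts add before and after the inner
        sequence of \<open>w\<close>. The letters touching \<open>w\<close> involve its end segments
        and agree with those of \<open>w'\<close> by \<open>pu\<close> and
        \<open>sv\<close>.\<close>
      define uw where "uw = (if a \<in> set u then map L (mid a u) @ [L (suf a u @ pre a w)] else [])"
      define wv where "wv = (if a \<in> set v then [L (suf a w @ pre a v)] @ map L (mid a v) else [])"
      have uw: "uw \<in> lists ?A'"
      proof (cases "a \<in> set u")
        case True
        have "suf a u @ pre a w \<in> lists ?B" using sil[OF u True] sil[OF w(1) wa] by simp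
        then show ?thesis unfolding uw_def using mid_in[OF u True] by simp
      qed (simp add: uw_def)
      have wv: "wv \<in> lists ?A'"
      proof (cases "a \<in> set v")
        case True
        have "suf a w @ pre a v \<in> lists ?B" using sil[OF v True] sil[OF w(1) wa] by simp
        then show ?thesis unfolding wv_def using mid_in[OF v True] by simp
      qed (simp add: wv_def)
      have m': "F\<^sub>2 (uw @ map L (mid a w) @ wv) = F\<^sub>2 (uw @ map L (mid a w') @ wv)"
        by (rule m[OF uw wv])
      show ?thesis
      proof (cases "a \<in> set u")
        case ua: True
        note su = sil[OF u ua]
        have pu: "L (suf a u @ pre a w) = L (suf a u @ pre a w')"
          by (rule L, rule p) (use su in auto)
        show ?thesis
        proof (cases "a \<in> set v")
          case va: True
          have sv: "L (suf a w @ pre a v) = L (suf a w' @ pre a v)"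
            by (rule L, rule s) (use sil[OF v va] in auto)
          show ?thesis using ua va wa w'a m' pu sv
            by (simp add: F2 split_append uw_def wv_def)
        next
          case va: False
          show ?thesis using ua va wa w'a m' pu s[OF no[OF v va]]
            by (simp add: F2 split_append uw_def wv_def)
        qed
      next
        case ua: False
        show ?thesis
        proof (cases "a \<in> set v")
          case va: True
          have sv: "L (suf a w @ pre a v) = L (suf a w' @ pre a v)"
            by (rule L, rule s) (use sil[OF v va] in auto)
          show ?thesis using ua va wa w'a m' p[OF no[OF u ua]] sv
            by (simp add: F2 split_append uw_def wv_def)
        next
          case va: False
          show ?thesis using ua va wa w'a m' p[OF no[OF u ua]] s[OF no[OF v va]]
            by (simp add: F2 split_append uw_def wv_def)
        qed
      qed
    qed
  next
    fix m x
    assume m: "max n\<^sub>1 (Suc n\<^sub>2) \<le> m" and x: "x \<in> lists A"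
    show "K (wpow m x) = K (wpow (Suc m) x)"
    proof (cases "a \<in> set x")
      case False
      then have "a \<notin> set (wpow m x)" "a \<notin> set (wpow (Suc m) x)"
        using set_wpow by (metis subsetD)+
      then show ?thesis using n1[of m x] m no[OF x False] by (simp add: K_def del: wpow_simps)
    next
      case True
      \<comment> \<open>The inner sequence of the \<open>m\<close>-th power contains only a power
        with exponent \<open>m - 1\<close>, whence the bound \<open>Suc n\<^sub>2\<close>.\<close>
      obtain k where k: "m = Suc k" "k \<ge> n\<^sub>2" using m by (cases m) auto
      let ?y = "map L ([suf a x @ pre a x] @ mid a x)"
      have "?y \<in> lists ?A'" using mid_in[OF x True] sil[OF x True] by simp
      then have "syn ?A' F\<^sub>2 (wpow k ?y) = syn ?A' F\<^sub>2 (wpow (Suc k) ?y)"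
        using n2[OF k(2)] by blast
      from syn_cong[OF this mid_in[OF x True], of "[]"]
      have eq: "syn ?A' F\<^sub>2 (map L (mid a (wpow m x))) = syn ?A' F\<^sub>2 (map L (mid a (wpow (Suc m) x)))"
        using split_wpow[OF True, of k] split_wpow[OF True, of "Suc k"]
        by (simp add: k(1) map_wpow del: wpow_simps)
      have "a \<in> set (wpow m x)" "a \<in> set (wpow (Suc m) x)" using True k(1) by auto
      then show ?thesis
        using eq split_wpow[OF True, of k] split_wpow[OF True, of "Suc k"]
        by (simp add: K_def k(1) del: wpow_simps)
    qed
  qed
qed

section \<open>Covering ordered actions by aperiodic colourings\<close>

text \<open>The assumption \<open>cover\<close> is the order-theoretic shadow of Henckell's operation on pointlike sets: it
  weakens aperiodicity of \<^term>\<open>S\<close> to the existence of a common upper bound of two consecutive powers.\<close>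

locale covering_action =
  fixes Q :: "'q::order set" and S :: "('q \<Rightarrow> 'q) set"
  assumes fin: "finite Q"
    and id_in: "id \<in> S"
    and comp_in: "s \<in> S \<Longrightarrow> t \<in> S \<Longrightarrow> s \<circ> t \<in> S"
    and maps: "s \<in> S \<Longrightarrow> q \<in> Q \<Longrightarrow> s q \<in> Q"
    and mono: "s \<in> S \<Longrightarrow> p \<in> Q \<Longrightarrow> q \<in> Q \<Longrightarrow> p \<le> q \<Longrightarrow> s p \<le> s q"
    and cover: "s \<in> S \<Longrightarrow> \<exists>y\<in>S. \<exists>n. \<forall>q\<in>Q. (s ^^ n) q \<le> y q \<and> (s ^^ Suc n) q \<le> y q"
begin

lemma funpow_in: "s \<in> S \<Longrightarrow> s ^^ n \<in> S"
  by (induction n) (auto intro: comp_in id_in)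

lemma fold_in: "w \<in> lists S \<Longrightarrow> fold (\<lambda>f. f) w \<in> S"
  by (induction w) (auto simp: comp_in id_in)

end

section \<open>Iterates of self-maps of finite sets\<close>

lemma funpow_eventually_periodic:
  assumes "finite X" "f \<in> X \<rightarrow> X"
  obtains i p where "p > 0" "\<And>m x. m \<ge> i \<Longrightarrow> x \<in> X \<Longrightarrow> (f ^^ (m + p)) x = (f ^^ m) x"
proof -
  have img: "(f ^^ n) x \<in> X" if "x \<in> X" for n x
    by (induction n) (use assms(2) that in auto)
  \<comment> \<open>The pigeonhole principle is applied to whole restricted iterates, which makes
    preperiod and period uniform in the starting point.\<close>
  have "range (\<lambda>n. restrict (f ^^ n) X) \<subseteq> X \<rightarrow>\<^sub>E X"
    using img by (auto simp: PiE_iff)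
  then have "finite (range (\<lambda>n. restrict (f ^^ n) X))"
    by (rule finite_subset) (intro finite_PiE assms(1))
  then obtain i j where "i \<noteq> j" "restrict (f ^^ i) X = restrict (f ^^ j) X"
    using finite_imageD[of "\<lambda>n. restrict (f ^^ n) X" UNIV, OF _ injI] infinite_UNIV_nat by meson
  then have "\<exists>i j. i < j \<and> restrict (f ^^ i) X = restrict (f ^^ j) X"
    by (metis linorder_neqE_nat)
  then obtain i j where ij: "i < j" "restrict (f ^^ i) X = restrict (f ^^ j) X"
    by meson
  have base: "(f ^^ j) x = (f ^^ i) x" if "x \<in> X" for x
    using fun_cong[OF ij(2), of x] that by simp
  have "(f ^^ (m + (j - i))) x = (f ^^ m) x" if "m \<ge> i" "x \<in> X" for m x
  proof -
    have "m + (j - i) = (m - i) + j" using ij(1) that(1) by simp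
    then have "(f ^^ (m + (j - i))) x = (f ^^ (m - i)) ((f ^^ i) x)"
      using base[OF that(2)] by (simp add: funpow_add)
    also have "\<dots> = (f ^^ (m - i + i)) x" by (simp only: funpow_add o_apply)
    finally show ?thesis using that(1) by simp
  qed
  then show ?thesis using ij(1) that[of "j - i" i] by simp
qed

text \<open>A surjection of a finite set is injective, so the preperiod can be cancelled.\<close>

lemma perm_funpow_id:
  assumes "finite Q" "s ` Q = Q"
  obtains k where "k > 0" "\<And>q. q \<in> Q \<Longrightarrow> (s ^^ k) q = q"
proof -
  have img: "(s ^^ n) ` Q = Q" for n
  proof (induction n)
    case (Suc n)
    have "(s ^^ Suc n) ` Q = s ` ((s ^^ n) ` Q)" by (simp add: image_image o_def)
    then show ?case using Suc assms(2) by simp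
  qed simp
  have inj: "inj_on (s ^^ n) Q" for n
    using img[of n] by (simp add: assms(1) eq_card_imp_inj_on)
  have "s \<in> Q \<rightarrow> Q" using assms(2) by auto
  then obtain i p where ip: "p > 0" "\<And>m q. m \<ge> i \<Longrightarrow> q \<in> Q \<Longrightarrow> (s ^^ (m + p)) q = (s ^^ m) q"
    using funpow_eventually_periodic[OF assms(1)] by metis
  have "(s ^^ p) q = q" if "q \<in> Q" for q
  proof -
    have "(s ^^ i) ((s ^^ p) q) = (s ^^ i) q" using ip(2)[OF order_refl that] by (simp add: funpow_add)
    moreover have "(s ^^ p) q \<in> Q" using img[of p] that by blast
    ultimately show ?thesis using that by (rule inj_onD[OF inj])
  qed
  then show ?thesis using ip(1) that by blast
qed

lemma funpow_fact_eventually: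
  assumes "finite X" "f \<in> X \<rightarrow> X"
  obtains N where "N > 0" "\<And>n x. n \<ge> N \<Longrightarrow> x \<in> X \<Longrightarrow> (f ^^ fact n) x = (f ^^ fact N) x"
proof -
  obtain i p where ip: "p > 0" "\<And>m x. m \<ge> i \<Longrightarrow> x \<in> X \<Longrightarrow> (f ^^ (m + p)) x = (f ^^ m) x"
    using funpow_eventually_periodic[OF assms] by metis
  have per: "(f ^^ (m + p * k)) x = (f ^^ m) x" if "m \<ge> i" "x \<in> X" for m k x
  proof (induction k)
    case (Suc k)
    have "m + p * Suc k = (m + p * k) + p" by simp
    moreover have "m + p * k \<ge> i" using that(1) by simp
    ultimately show ?case using ip(2)[of "m + p * k" x] that(2) Suc by metis
  qed simp
  \<comment> \<open>Being at least \<open>p\<close> makes the period divide all later factorials;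
    being at least \<open>i\<close> puts these factorials beyond the preperiod.\<close>
  define N where "N = max i p"
  have "(f ^^ fact n) x = (f ^^ fact N) x" if n: "n \<ge> N" and x: "x \<in> X" for n x
  proof -
    have "p dvd fact N" using ip(1) by (simp add: N_def dvd_fact)
    moreover have "p dvd fact n" using ip(1) n by (simp add: N_def dvd_fact)
    moreover have le: "(fact N :: nat) \<le> fact n" using n by (rule fact_mono_nat)
    ultimately have "p dvd fact n - fact N" by (simp add: dvd_diff_nat)
    then obtain k where "fact n - fact N = p * k" by blast
    then have "fact n = fact N + p * k" using le by simp
    moreover have "i \<le> fact N" using fact_ge_self[of N] by (simp add: N_def)
    ultimately show ?thesis using per x by metis
  qed
  moreover have "N > 0" using ip(1) by (simp add: N_def)
  ultimately show ?thesis using that by blast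
qed

section \<open>Bounds for words of permutations\<close>

context covering_action begin

text \<open>The map \<open>y\<close> from \<open>cover\<close> dominates \<open>s ^^ n\<close> and
  \<open>s ^^ Suc n\<close>. Composing with a further power of \<open>s\<close> that completes
  \<open>n\<close> to a multiple of the order \<open>k\<close> moves these two down to the identity
  and \<open>s\<close>.\<close>

lemma perm_cover_one:
  assumes "s \<in> S" "s ` Q = Q"
  obtains y where "y \<in> S" "\<And>q. q \<in> Q \<Longrightarrow> q \<le> y q" "\<And>q. q \<in> Q \<Longrightarrow> s q \<le> y q"
proof -
  obtain y n where y: "y \<in> S" "\<And>q. q \<in> Q \<Longrightarrow> (s ^^ n) q \<le> y q \<and> (s ^^ Suc n) q \<le> y q"
    using cover[OF assms(1)] by blast
  obtain k where k: "k > 0" "\<And>q. q \<in> Q \<Longrightarrow> (s ^^ k) q = q"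
    using perm_funpow_id[OF fin assms(2)] by blast
  have kn: "(s ^^ (k * n)) q = q" if "q \<in> Q" for q
    by (induction n) (use k that in \<open>auto simp: funpow_add\<close>)
  define m where "m = k * n - n"
  have m: "n + m = k * n" using k(1) by (simp add: m_def)
  define z where "z = y \<circ> (s ^^ m)"
  have "z \<in> S" unfolding z_def by (intro comp_in y(1) funpow_in assms(1))
  moreover have "q \<le> z q \<and> s q \<le> z q" if q: "q \<in> Q" for q
  proof -
    have mq: "(s ^^ m) q \<in> Q" using funpow_in[OF assms(1)] maps q by blast
    have "(s ^^ n) ((s ^^ m) q) = q" using kn[OF q] by (simp add: funpow_add flip: m)
    moreover from this have "(s ^^ Suc n) ((s ^^ m) q) = s q" by simp
    ultimately show ?thesis using y(2)[OF mq] by (auto simp: z_def)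
  qed
  ultimately show ?thesis using that by blast
qed

text \<open>Each permutation in \<^term>\<open>S\<close> has an upper bound above the identity as well, so the composite of
  the bounds of finitely many permutations dominates all of them.\<close>

lemma perm_cover:
  assumes "A \<subseteq> S" "\<And>a. a \<in> A \<Longrightarrow> a ` Q = Q"
  obtains y where "y \<in> S" "\<And>w q. w \<in> lists A \<Longrightarrow> q \<in> Q \<Longrightarrow> fold (\<lambda>f. f) w q \<le> y q"
proof -
  let ?act = "fold (\<lambda>f::'q \<Rightarrow> 'q. f)"
  have img: "?act w ` Q = Q" if "w \<in> lists A" for w
    using that
  proof (induction w)
    case (Cons a w)
    have "?act (a # w) ` Q = ?act w ` (a ` Q)" by (simp add: image_image o_def)
    then show ?case using Cons assms(2) by simp
  qed simp
  have inS: "?act w \<in> S" if "w \<in> lists A" for w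
    by (rule fold_in[OF subsetD[OF lists_mono[OF assms(1)] that]])
  have fin_cover: "\<exists>y\<in>S. \<forall>q\<in>Q. q \<le> y q \<and> (\<forall>w\<in>W. ?act w q \<le> y q)"
    if "finite W" "W \<subseteq> lists A" for W
    using that
  proof (induction W rule: finite_induct)
    case empty
    show ?case using id_in by (auto intro!: bexI[of _ id])
  next
    case (insert w W)
    then obtain y where y: "y \<in> S" "\<And>q. q \<in> Q \<Longrightarrow> q \<le> y q"
      "\<And>q w. q \<in> Q \<Longrightarrow> w \<in> W \<Longrightarrow> ?act w q \<le> y q" by auto
    have w: "w \<in> lists A" using insert by simp
    obtain z where z: "z \<in> S" "\<And>q. q \<in> Q \<Longrightarrow> q \<le> z q" "\<And>q. q \<in> Q \<Longrightarrow> ?act w q \<le> z q"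
      by (rule perm_cover_one[OF inS[OF w] img[OF w]]) blast
    have "q \<le> y (z q) \<and> (\<forall>v\<in>insert w W. ?act v q \<le> y (z q))" if q: "q \<in> Q" for q
    proof -
      have zq: "z q \<in> Q" using maps z(1) q by blast
      have "y q \<le> y (z q)" using mono y(1) q zq z(2) by blast
      then show ?thesis
        using y(2)[OF zq] y(2,3)[OF q] z(2,3)[OF q] by (auto intro: order_trans)
    qed
    then show ?case using comp_in[OF y(1) z(1)] by (intro bexI[of _ "y \<circ> z"]) auto
  qed
  \<comment> \<open>Infinitely many words induce only finitely many self-maps of \<open>Q\<close>,
    so \<open>fin_cover\<close> need only be applied to representatives \<open>W\<close>.\<close>
  let ?r = "\<lambda>w. restrict (?act w) Q"
  have "?r w \<in> Q \<rightarrow>\<^sub>E Q" if "w \<in> lists A" for w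
    using img[OF that] by (simp add: image_subset_iff_funcset[symmetric])
  then have "?r ` lists A \<subseteq> Q \<rightarrow>\<^sub>E Q" by (rule image_subsetI)
  then have "finite (?r ` lists A)"
    by (rule finite_subset) (intro finite_PiE fin)
  then obtain W where W: "W \<subseteq> lists A" "finite W" "?r ` lists A = ?r ` W"
    using finite_subset_image[OF _ order_refl, of ?r "lists A"] by meson
  obtain y where y: "y \<in> S" "\<And>q w. q \<in> Q \<Longrightarrow> w \<in> W \<Longrightarrow> ?act w q \<le> y q"
    using fin_cover[OF W(2,1)] by blast
  have "?act w q \<le> y q" if "w \<in> lists A" "q \<in> Q" for w q
  proof -
    have "?r w \<in> ?r ` W" unfolding W(3)[symmetric] using that(1) by (rule imageI)
    then obtain w' where w': "?r w = ?r w'" "w' \<in> W" by (rule imageE)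
    have "?act w q = ?act w' q" using fun_cong[OF w'(1), of q] that(2) by simp
    then show ?thesis using y(2)[OF that(2) w'(2)] by simp
  qed
  then show ?thesis using that y(1) by blast
qed

end

section \<open>Passing to the image of a letter\<close>

context covering_action begin

text \<open>The bound \<open>y\<close> for \<open>s = a \<circ> t\<close> need not begin with
  \<open>a\<close>, so it is replaced by \<open>s \<circ> y\<close>, which does. By monotonicity
  this raises the two dominated powers by one, and \<open>n\<close> becomes
  \<open>Suc n\<close>.\<close>

lemma covering_action_subset:
  assumes a: "a \<in> S"
  shows "covering_action (a ` Q) (insert id ((\<circ>) a ` S))"
proof
  let ?S = "insert id ((\<circ>) a ` S)"
  have sub: "?S \<subseteq> S" using a id_in comp_in by auto
  have subQ: "a ` Q \<subseteq> Q" using maps[OF a] by auto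
  show "finite (a ` Q)" using fin by simp
  show "id \<in> ?S" by simp
  show "s \<circ> t \<in> ?S" if st: "s \<in> ?S" "t \<in> ?S" for s t
  proof (cases "s = id")
    case False
    then obtain s' where "s' \<in> S" "s = a \<circ> s'" using st(1) by auto
    then show ?thesis using comp_in st(2) sub by (auto simp: comp_assoc)
  qed (use st in auto)
  show "s q \<in> a ` Q" if "s \<in> ?S" "q \<in> a ` Q" for s q
    using that maps a by auto
  show "s p \<le> s q" if "s \<in> ?S" "p \<in> a ` Q" "q \<in> a ` Q" "p \<le> q" for s p q
    using mono[of s p q] that sub subQ by blast
  show "\<exists>y\<in>?S. \<exists>n. \<forall>q\<in>a ` Q. (s ^^ n) q \<le> y q \<and> (s ^^ Suc n) q \<le> y q" if s: "s \<in> ?S" for s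
  proof (cases "s = id")
    case True
    then show ?thesis by (intro bexI[of _ id] exI[of _ 0]) auto
  next
    case False
    then obtain t where t: "t \<in> S" "s = a \<circ> t" using s by auto
    then have sS: "s \<in> S" using a comp_in by blast
    obtain y n where y: "y \<in> S" "\<And>q. q \<in> Q \<Longrightarrow> (s ^^ n) q \<le> y q \<and> (s ^^ Suc n) q \<le> y q"
      using cover[OF sS] by blast
    have "(s ^^ Suc n) q \<le> (s \<circ> y) q \<and> (s ^^ Suc (Suc n)) q \<le> (s \<circ> y) q" if q: "q \<in> Q" for q
    proof -
      have "s ((s ^^ n) q) \<le> s (y q)" "s ((s ^^ Suc n) q) \<le> s (y q)"
        using y(2)[OF q] maps[OF funpow_in[OF sS] q] maps[OF y(1) q] mono[OF sS] by blast+
      then show ?thesis by simp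
    qed
    moreover have "s \<circ> y \<in> ?S" using t y(1) comp_in by (auto simp: comp_assoc)
    ultimately show ?thesis using subQ by blast
  qed
qed

text \<open>Segment by segment, the action of \<open>z\<close> is replaced by its bound
  \<open>G z\<close>; monotonicity of \<open>a\<close> and of the action of the remaining word
  carries the inequality through.\<close>

lemma fold_join_le:
  assumes a: "a \<in> S" "B \<subseteq> S" and G: "\<And>z. z \<in> lists B \<Longrightarrow> G z \<in> S"
    "\<And>z q. z \<in> lists B \<Longrightarrow> q \<in> Q \<Longrightarrow> fold (\<lambda>f. f) z q \<le> G z q"
    and "zs \<in> lists (lists B)" "q \<in> Q"
  shows "fold (\<lambda>f. f) (concat (map (\<lambda>z. z @ [a]) zs)) q \<le> fold (\<lambda>f. f) (map (\<lambda>z. a \<circ> G z) zs) q"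
  using assms(5,6)
proof (induction zs arbitrary: q rule: list.induct)
  case (Cons z zs)
  let ?act = "fold (\<lambda>f::'q \<Rightarrow> 'q. f)"
  let ?r = "concat (map (\<lambda>z. z @ [a]) zs)"
  have z: "z \<in> lists B" "zs \<in> lists (lists B)" using Cons.prems(1) by simp_all
  have zS: "z \<in> lists S" using z(1) a(2) lists_mono by blast
  have "?r \<in> lists S" using z(2) a by (auto simp: in_lists_conv_set)
  then have rS: "?act ?r \<in> S" by (rule fold_in)
  have 1: "?act z q \<in> Q" "G z q \<in> Q" using Cons.prems(2) maps fold_in[OF zS] G(1)[OF z(1)] by auto
  then have "a (?act z q) \<le> a (G z q)" "a (?act z q) \<in> Q" and aG: "a (G z q) \<in> Q"
    using G(2)[OF z(1) Cons.prems(2)] mono[OF a(1)] maps[OF a(1)] by auto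
  then have "?act ?r (a (?act z q)) \<le> ?act ?r (a (G z q))" using mono[OF rS] by blast
  also have "\<dots> \<le> ?act (map (\<lambda>z. a \<circ> G z) zs) (a (G z q))"
    using Cons.IH[OF z(2) aG] .
  finally show ?case by (simp add: o_def)
qed simp

end

text \<open>Wilke's induction on the pair (\<^term>\<open>card Q\<close>, \<^term>\<open>card A\<close>): if some letter \<^term>\<open>a\<close> shrinks \<^term>\<open>Q\<close>,
  then the \<^term>\<open>a\<close>-free segments are handled over a smaller alphabet, and the sequence of inner
  segments, each followed by \<^term>\<open>a\<close>, acts on the smaller set \<^term>\<open>a ` Q\<close>.\<close>

lemma aperiodic_cover:
  fixes Q :: "'q::order set"
  assumes "covering_action Q S" "finite A" "A \<subseteq> S"
  shows "\<exists>F. (\<forall>w\<in>lists A. F w \<in> S \<and> (\<forall>q\<in>Q. fold (\<lambda>f. f) w q \<le> F w q)) \<and> aperiodic_on A F"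
  using assms
proof (induction "card Q" arbitrary: Q S A rule: less_induct)
  case less
  let ?act = "fold (\<lambda>f::'q \<Rightarrow> 'q. f)"
  from \<open>covering_action Q S\<close> interpret covering_action Q S .
  from less(3,4) show ?case
  proof (induction A rule: finite_psubset_induct)
    case (psubset A)
    show ?case
    proof (cases "\<forall>a\<in>A. a ` Q = Q")
      case True
      \<comment> \<open>Every letter permutes \<open>Q\<close>, so a constant colouring is enough,
        and its syntactic congruence is trivial.\<close>
      then obtain y where y: "y \<in> S" "\<And>w q. w \<in> lists A \<Longrightarrow> q \<in> Q \<Longrightarrow> ?act w q \<le> y q"
        using perm_cover[of A] psubset.prems by blast
      have "aperiodic_on A (\<lambda>_. y)"
        by (rule aperiodic_onI[where K = "\<lambda>_. ()" and n = 0]) auto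
      then show ?thesis using y by (intro exI[of _ "\<lambda>_. y"]) blast
    next
      case False
      then obtain a where a: "a \<in> A" "a ` Q \<noteq> Q" by blast
      then have aS: "a \<in> S" using psubset.prems by blast
      let ?B = "A - {a}"
      have BS: "?B \<subseteq> S" using psubset.prems by blast
      have "?B \<subset> A" using a(1) by blast
      from psubset.IH[OF this BS] obtain F\<^sub>1 where
        F1': "\<forall>w\<in>lists ?B. F\<^sub>1 w \<in> S \<and> (\<forall>q\<in>Q. ?act w q \<le> F\<^sub>1 w q)" and ap1: "aperiodic_on ?B F\<^sub>1"
        by (elim exE conjE)
      have F1: "F\<^sub>1 w \<in> S" "q \<in> Q \<Longrightarrow> ?act w q \<le> F\<^sub>1 w q" if "w \<in> lists ?B" for w q
        using F1' that by blast+
      \<comment> \<open>A segment together with the \<open>a\<close> after it becomes one letter of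
        a new alphabet. That alphabet is finite because \<open>F\<^sub>1\<close> factors through its
        finitely many syntactic classes.\<close>
      define L where "L z = a \<circ> F\<^sub>1 z" for z
      let ?A' = "L ` lists ?B"
      let ?S = "insert id ((\<circ>) a ` S)"
      have sub: "?S \<subseteq> S" using aS id_in comp_in by auto
      have "a ` Q \<subset> Q" using a(2) maps[OF aS] by auto
      then have "card (a ` Q) < card Q" using fin by (rule psubset_card_mono[rotated])
      moreover have "finite ?A'"
        by (rule finite_image_factor[where K = "syn ?B F\<^sub>1"])
           (use ap1 in \<open>auto simp: aperiodic_on_def L_def dest!: syn_imp_eq\<close>)
      moreover have "?A' \<subseteq> ?S" using F1(1) by (auto simp: L_def)
      ultimately have "\<exists>F. (\<forall>w\<in>lists ?A'. F w \<in> ?S \<and> (\<forall>q\<in>a ` Q. ?act w q \<le> F w q)) \<and> aperiodic_on ?A' F"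
        by (intro less(1) covering_action_subset aS)
      then obtain F\<^sub>2 where
        F2': "\<forall>w\<in>lists ?A'. F\<^sub>2 w \<in> ?S \<and> (\<forall>q\<in>a ` Q. ?act w q \<le> F\<^sub>2 w q)" and ap2: "aperiodic_on ?A' F\<^sub>2"
        by (elim exE conjE)
      have F2: "F\<^sub>2 w \<in> ?S" "q \<in> a ` Q \<Longrightarrow> ?act w q \<le> F\<^sub>2 w q" if "w \<in> lists ?A'" for w q
        using bspec[OF F2' that] by blast+
      \<comment> \<open>The first segment still acts on all of \<open>Q\<close>. After the first
        \<open>a\<close> the state lies in the image of \<open>a\<close>, where the bound
        \<open>F\<^sub>2\<close> is valid. The last segment is followed by no \<open>a\<close> and
        again needs \<open>F\<^sub>1\<close>.\<close>
      define F where "F w = (if a \<in> set w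
        then F\<^sub>1 (suf a w) \<circ> F\<^sub>2 (map L (mid a w)) \<circ> a \<circ> F\<^sub>1 (pre a w) else F\<^sub>1 w)" for w
      have "aperiodic_on A F"
        by (rule aperiodic_on_glue[OF ap1 ap2, where h = id and g = "\<lambda>f g k. k \<circ> g \<circ> a \<circ> f"])
           (auto simp: L_def F_def)
      moreover have "F w \<in> S \<and> (\<forall>q\<in>Q. ?act w q \<le> F w q)" if w: "w \<in> lists A" for w
      proof (cases "a \<in> set w")
        case False
        then have "w \<in> lists ?B" using w by (auto simp: in_lists_conv_set)
        then show ?thesis using F1 False by (simp add: F_def)
      next
        case True
        note wB = split_in_lists[OF w True]
        have mA: "map L (mid a w) \<in> lists ?A'" using wB(3) by (auto simp: in_lists_conv_set)
        have mS: "F\<^sub>2 (map L (mid a w)) \<in> S" using F2(1)[OF mA] sub by blast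
        let ?r = "concat (map (\<lambda>z. z @ [a]) (mid a w))"
        have "?r \<in> lists S" using wB(3) BS aS by (auto simp: in_lists_conv_set)
        then have rS: "?act ?r \<in> S" by (rule fold_in)
        have pS: "?act (pre a w) \<in> S" and sS: "?act (suf a w) \<in> S"
          by (rule fold_in[OF subsetD[OF lists_mono[OF BS]]], rule wB)+
        have "?act w q \<le> F w q" if q: "q \<in> Q" for q
        proof -
          define q\<^sub>1 where "q\<^sub>1 = a (F\<^sub>1 (pre a w) q)"
          have p: "?act (pre a w) q \<in> Q" "F\<^sub>1 (pre a w) q \<in> Q"
            using q maps pS F1(1)[OF wB(1)] by auto
          then have q1: "a (?act (pre a w) q) \<le> q\<^sub>1" "a (?act (pre a w) q) \<in> Q" "q\<^sub>1 \<in> Q" "q\<^sub>1 \<in> a ` Q"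
            unfolding q\<^sub>1_def using mono[OF aS] F1(2)[OF wB(1) q] maps[OF aS] by auto
          have "?act ?r (a (?act (pre a w) q)) \<le> ?act ?r q\<^sub>1" using mono[OF rS] q1 by blast
          also have "\<dots> \<le> ?act (map L (mid a w)) q\<^sub>1"
            unfolding L_def by (rule fold_join_le[OF aS BS F1 wB(3) q1(3)])
          also have "\<dots> \<le> F\<^sub>2 (map L (mid a w)) q\<^sub>1"
            using F2(2)[OF mA q1(4)] .
          finally have "?act (suf a w) (?act ?r (a (?act (pre a w) q))) \<le> ?act (suf a w) (F\<^sub>2 (map L (mid a w)) q\<^sub>1)"
            using mono[OF sS] maps[OF rS q1(2)] maps[OF mS q1(3)] by blast
          also have "\<dots> \<le> F\<^sub>1 (suf a w) (F\<^sub>2 (map L (mid a w)) q\<^sub>1)"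
            using F1(2)[OF wB(2)] maps[OF mS q1(3)] by blast
          also have "?act (suf a w) (?act ?r (a (?act (pre a w) q))) = ?act w q"
            using arg_cong[OF split_join[OF True], of "\<lambda>w. ?act w q"] by simp
          finally show ?thesis using True by (simp add: F_def q\<^sub>1_def)
        qed
        moreover have "F w \<in> S"
          using True comp_in mS aS F1(1) wB(1,2) by (simp add: F_def)
        ultimately show ?thesis by blast
      qed
      ultimately show ?thesis by blast
    qed
  qed
qed

section \<open>Implicit operations\<close>

definition fm_pow :: "fm \<Rightarrow> nat \<Rightarrow> nat \<Rightarrow> nat" where
  "fm_pow T x n = (fm_mul T x ^^ n) (fm_one T)"

lemma fm_one_in: "finite_monoid T \<Longrightarrow> fm_one T \<in> fm_car T"
  and fm_mul_in: "finite_monoid T \<Longrightarrow> x \<in> fm_car T \<Longrightarrow> y \<in> fm_car T \<Longrightarrow> fm_mul T x y \<in> fm_car T"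
  and fm_assoc: "finite_monoid T \<Longrightarrow> x \<in> fm_car T \<Longrightarrow> y \<in> fm_car T \<Longrightarrow> z \<in> fm_car T \<Longrightarrow>
    fm_mul T (fm_mul T x y) z = fm_mul T x (fm_mul T y z)"
  and fm_one_left: "finite_monoid T \<Longrightarrow> x \<in> fm_car T \<Longrightarrow> fm_mul T (fm_one T) x = x"
  and fm_one_right: "finite_monoid T \<Longrightarrow> x \<in> fm_car T \<Longrightarrow> fm_mul T x (fm_one T) = x"
  by (simp_all add: finite_monoid_def)

lemmas fm_simps = fm_one_in fm_mul_in fm_assoc fm_one_left fm_one_right

lemma finite_fm_car [simp]: "finite (fm_car T)"
  by (simp add: fm_car_def)

lemma fm_pow_in: "finite_monoid T \<Longrightarrow> x \<in> fm_car T \<Longrightarrow> fm_pow T x n \<in> fm_car T"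
  unfolding fm_pow_def by (induction n) (auto simp: fm_simps)

lemma fm_hom_pow:
  assumes "finite_monoid T" "fm_hom h T T'" "x \<in> fm_car T"
  shows "h (fm_pow T x n) = fm_pow T' (h x) n"
proof (induction n)
  case 0
  then show ?case using assms(2) by (simp add: fm_pow_def fm_hom_def)
next
  case (Suc n)
  have "fm_pow T x (Suc n) = fm_mul T x (fm_pow T x n)" by (simp add: fm_pow_def)
  then show ?case
    using Suc assms fm_pow_in[of T x n] by (simp add: fm_pow_def fm_hom_def)
qed

lemma fm_pow_fact_eventually:
  assumes "finite_monoid T" "x \<in> fm_car T"
  obtains z where "z \<in> fm_car T" "\<forall>\<^sub>F n in sequentially. fm_pow T x (fact n) = z"
proof -
  have "fm_mul T x \<in> fm_car T \<rightarrow> fm_car T" using assms by (auto simp: fm_mul_in)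
  then obtain N where "\<And>n y. n \<ge> N \<Longrightarrow> y \<in> fm_car T \<Longrightarrow>
      (fm_mul T x ^^ fact n) y = (fm_mul T x ^^ fact N) y"
    by (rule funpow_fact_eventually[OF finite_fm_car]) blast
  then have "\<forall>n\<ge>N. fm_pow T x (fact n) = fm_pow T x (fact N)"
    unfolding fm_pow_def using fm_one_in[OF assms(1)] by blast
  then have "\<forall>\<^sub>F n in sequentially. fm_pow T x (fact n) = fm_pow T x (fact N)"
    unfolding eventually_sequentially by (rule exI)
  then show ?thesis by (rule that[OF fm_pow_in[OF assms]])
qed

lemma eventually_const_unique:
  assumes "\<forall>\<^sub>F n in sequentially. f n = a" "\<forall>\<^sub>F n in sequentially. f n = b"
  shows "a = b"
proof -
  have "\<forall>\<^sub>F n in sequentially. a = b" using assms by eventually_elim simp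
  then show ?thesis by simp
qed

definition fm_omega :: "fm \<Rightarrow> nat \<Rightarrow> nat" where
  "fm_omega T x = (SOME z. \<forall>\<^sub>F n in sequentially. fm_pow T x (fact n) = z)"

lemma fm_omega:
  assumes "finite_monoid T" "x \<in> fm_car T"
  shows "\<forall>\<^sub>F n in sequentially. fm_pow T x (fact n) = fm_omega T x" "fm_omega T x \<in> fm_car T"
proof -
  obtain z where z: "z \<in> fm_car T" "\<forall>\<^sub>F n in sequentially. fm_pow T x (fact n) = z"
    by (rule fm_pow_fact_eventually[OF assms])
  show ev: "\<forall>\<^sub>F n in sequentially. fm_pow T x (fact n) = fm_omega T x"
    unfolding fm_omega_def by (rule someI[of _ z]) (rule z)
  show "fm_omega T x \<in> fm_car T" using eventually_const_unique[OF ev z(2)] z(1) by simp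
qed

lemma fm_hom_omega:
  assumes "finite_monoid T" "finite_monoid T'" "fm_hom h T T'" "x \<in> fm_car T"
  shows "h (fm_omega T x) = fm_omega T' (h x)"
proof -
  have "h x \<in> fm_car T'" using assms(3,4) by (simp add: fm_hom_def)
  note ev = fm_omega(1)[OF assms(2) this]
  have "\<forall>\<^sub>F n in sequentially. fm_pow T' (h x) (fact n) = h (fm_omega T x)"
    using fm_omega(1)[OF assms(1,4)]
    by (rule eventually_mono) (simp flip: fm_hom_pow[OF assms(1,3,4)])
  from this ev show ?thesis by (rule eventually_const_unique)
qed

section \<open>Pointwise monoid structure\<close>

lemma testsD: "(T, f) \<in> tests A \<Longrightarrow> finite_monoid T" "(T, f) \<in> tests A \<Longrightarrow> f \<in> A \<rightarrow>\<^sub>E fm_car T"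
  by (simp_all add: tests_def)

lemma tests_hom:
  "(T, f) \<in> tests A \<Longrightarrow> finite_monoid T' \<Longrightarrow> fm_hom h T T' \<Longrightarrow> (T', restrict (h \<circ> f) A) \<in> tests A"
  by (auto simp: tests_def fm_hom_def PiE_iff)

lemma Omega_in: "u \<in> Omega A \<Longrightarrow> (T, f) \<in> tests A \<Longrightarrow> u (T, f) \<in> fm_car T"
  unfolding Omega_def by blast

lemma Omega_hom: "u \<in> Omega A \<Longrightarrow> (T, f) \<in> tests A \<Longrightarrow> finite_monoid T' \<Longrightarrow> fm_hom h T T' \<Longrightarrow>
    h (u (T, f)) = u (T', restrict (h \<circ> f) A)"
  unfolding Omega_def by blast

lemma Omega_ext: "u \<in> Omega A \<Longrightarrow> u \<in> extensional (tests A)"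
  unfolding Omega_def by blast

lemma OmegaI:
  assumes "\<And>T f. (T, f) \<in> tests A \<Longrightarrow> F T f \<in> fm_car T"
    and "\<And>T f T' h. (T, f) \<in> tests A \<Longrightarrow> finite_monoid T' \<Longrightarrow> fm_hom h T T' \<Longrightarrow>
       h (F T f) = F T' (restrict (h \<circ> f) A)"
  shows "restrict (\<lambda>p. F (fst p) (snd p)) (tests A) \<in> Omega A"
proof -
  let ?u = "restrict (\<lambda>p. F (fst p) (snd p)) (tests A)"
  have "?u (T, f) \<in> fm_car T" if "(T, f) \<in> tests A" for T f
    using assms(1) that by simp
  moreover have "h (?u (T, f)) = ?u (T', restrict (h \<circ> f) A)"
    if "(T, f) \<in> tests A" "finite_monoid T'" "fm_hom h T T'" for T f T' h
    using assms(2)[OF that] tests_hom[OF that] that(1) by simp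
  ultimately show ?thesis unfolding Omega_def by blast
qed

lemma om_mul_apply: "p \<in> tests A \<Longrightarrow> om_mul A u v p = fm_mul (fst p) (u p) (v p)"
  by (simp add: om_mul_def)

lemma om_one_apply: "p \<in> tests A \<Longrightarrow> om_one A p = fm_one (fst p)"
  by (simp add: om_one_def)

lemma om_one_in [simp]: "om_one A \<in> Omega A"
  unfolding om_one_def by (rule OmegaI) (auto simp: fm_one_in fm_hom_def dest: testsD)

lemma om_gen_in: "a \<in> A \<Longrightarrow> om_gen A a \<in> Omega A"
  unfolding om_gen_def by (rule OmegaI[where F = "\<lambda>T f. f a"]) (auto dest: testsD)

lemma om_mul_in [simp]:
  assumes "u \<in> Omega A" "v \<in> Omega A" shows "om_mul A u v \<in> Omega A"
proof -
  have "om_mul A u v = restrict (\<lambda>p. fm_mul (fst p) (u (fst p, snd p)) (v (fst p, snd p))) (tests A)"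
    by (simp add: om_mul_def)
  moreover have "\<dots> \<in> Omega A"
  proof (rule OmegaI)
    fix T f assume t: "(T, f) \<in> tests A"
    then show "fm_mul T (u (T, f)) (v (T, f)) \<in> fm_car T"
      using assms by (simp add: Omega_in fm_mul_in testsD(1))
    fix T' h assume h: "finite_monoid T'" "fm_hom h T T'"
    show "h (fm_mul T (u (T, f)) (v (T, f))) = fm_mul T' (u (T', restrict (h \<circ> f) A)) (v (T', restrict (h \<circ> f) A))"
      unfolding Omega_hom[OF assms(1) t h, symmetric] Omega_hom[OF assms(2) t h, symmetric]
      using h(2) Omega_in[OF assms(1) t] Omega_in[OF assms(2) t] by (simp add: fm_hom_def)
  qed
  ultimately show ?thesis by simp
qed

lemma Omega_eqI:
  assumes "u \<in> Omega A" "v \<in> Omega A" "\<And>T f. (T, f) \<in> tests A \<Longrightarrow> u (T, f) = v (T, f)"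
  shows "u = v"
  using assms(3) by (intro extensionalityI[OF Omega_ext[OF assms(1)] Omega_ext[OF assms(2)]]) auto

lemma om_assoc:
  "u \<in> Omega A \<Longrightarrow> v \<in> Omega A \<Longrightarrow> w \<in> Omega A \<Longrightarrow> om_mul A (om_mul A u v) w = om_mul A u (om_mul A v w)"
  by (rule Omega_eqI[of _ A]) (simp_all add: om_mul_apply fm_assoc Omega_in testsD(1))

lemma om_one_left: "u \<in> Omega A \<Longrightarrow> om_mul A (om_one A) u = u"
  by (rule Omega_eqI[of _ A]) (simp_all add: om_mul_apply om_one_apply fm_one_left Omega_in testsD(1))

lemma om_one_right: "u \<in> Omega A \<Longrightarrow> om_mul A u (om_one A) = u"
  by (rule Omega_eqI[of _ A]) (simp_all add: om_mul_apply om_one_apply fm_one_right Omega_in testsD(1))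

lemma om_pow_Suc: "om_pow A u (Suc n) = om_mul A u (om_pow A u n)"
  by (simp add: om_pow_def)

lemma om_pow_in [simp]: "u \<in> Omega A \<Longrightarrow> om_pow A u n \<in> Omega A"
  by (induction n) (simp_all add: om_pow_def)

lemma om_pow_apply: "u \<in> Omega A \<Longrightarrow> p \<in> tests A \<Longrightarrow> om_pow A u n p = fm_pow (fst p) (u p) n"
  by (induction n) (simp_all add: om_pow_def fm_pow_def om_one_apply om_mul_apply)

section \<open>Topology of the monoid of implicit operations\<close>

lemma Omega_subset_PiE: "Omega A \<subseteq> tests A \<rightarrow>\<^sub>E UNIV"
  by (auto simp: Omega_def PiE_def)

lemma topspace_OmTop [simp]: "topspace (OmTop A) = Omega A"
  unfolding OmTop_def using Omega_subset_PiE[of A] by auto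

lemma Hausdorff_OmTop: "Hausdorff_space (OmTop A)"
  unfolding OmTop_def
  by (intro Hausdorff_space_subtopology) (simp add: Hausdorff_space_product_topology)

lemma continuous_map_OmTop_apply:
  "p \<in> tests A \<Longrightarrow> continuous_map (OmTop A) (discrete_topology UNIV) (\<lambda>u. u p)"
  unfolding OmTop_def
  by (intro continuous_map_from_subtopology continuous_map_product_projection[of p "tests A" "\<lambda>_. discrete_topology UNIV"])

lemma continuous_map_into_OmTop:
  assumes "\<And>x. x \<in> topspace X \<Longrightarrow> g x \<in> Omega A"
    and "\<And>p. p \<in> tests A \<Longrightarrow> continuous_map X (discrete_topology UNIV) (\<lambda>x. g x p)"
  shows "continuous_map X (OmTop A) g"
  unfolding OmTop_def continuous_map_in_subtopology continuous_map_componentwise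
  using assms Omega_ext by blast

lemma continuous_map_discrete_comp:
  assumes "continuous_map X (discrete_topology UNIV) g"
  shows "continuous_map X (discrete_topology UNIV) (\<lambda>x. h (g x))"
  using continuous_map_compose[OF assms, of "discrete_topology UNIV" h] by (simp add: o_def)

lemma openin_OmTop_basic:
  assumes "openin (OmTop A) U" "u \<in> U"
  obtains I where "finite I" "I \<subseteq> tests A" "\<forall>v\<in>Omega A. (\<forall>p\<in>I. v p = u p) \<longrightarrow> v \<in> U"
proof -
  obtain V where V: "openin (product_topology (\<lambda>_. discrete_topology (UNIV :: nat set)) (tests A)) V" "U = V \<inter> Omega A"
    using assms(1) unfolding OmTop_def openin_subtopology by blast
  then obtain W where W: "finite {i \<in> tests A. W i \<noteq> UNIV}" "u \<in> Pi\<^sub>E (tests A) W" "Pi\<^sub>E (tests A) W \<subseteq> V"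
    using assms(2) unfolding openin_product_topology_alt by fastforce
  let ?I = "{i \<in> tests A. W i \<noteq> UNIV}"
  have "v \<in> U" if v: "v \<in> Omega A" "\<forall>p\<in>?I. v p = u p" for v
  proof -
    have "v p \<in> W p" if "p \<in> tests A" for p
    proof (cases "W p = UNIV")
      case False
      then have "v p = u p" using v(2) that by blast
      then show ?thesis using PiE_mem[OF W(2) that] by simp
    qed simp
    then have "v \<in> Pi\<^sub>E (tests A) W" using Omega_ext[OF v(1)] by (simp add: PiE_iff)
    then show ?thesis using W(3) V(2) v(1) by blast
  qed
  then have "\<forall>v\<in>Omega A. (\<forall>p\<in>?I. v p = u p) \<longrightarrow> v \<in> U" by blast
  moreover have "?I \<subseteq> tests A" by blast
  ultimately show ?thesis using W(1) by (intro that)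
qed

text \<open>The factors of the ambient product are infinite and discrete, so compactness comes from
  the finite carriers via Tychonoff. The set is closed because each defining condition involves at
  most two coordinates, on which a limit point agrees with a genuine implicit operation.\<close>

lemma compact_OmTop: "compact_space (OmTop A)"
proof -
  let ?P = "product_topology (\<lambda>_. discrete_topology (UNIV :: nat set)) (tests A)"
  have agree: "\<exists>u\<in>Omega A. \<forall>p\<in>I. u p = z p"
    if z: "z \<in> ?P closure_of Omega A" and I: "finite I" "I \<subseteq> tests A" for z I
  proof -
    let ?W = "Pi\<^sub>E (tests A) (\<lambda>p. if p \<in> I then {z p} else UNIV)"
    have fin: "finite {p \<in> tests A. (if p \<in> I then {z p} else UNIV) \<noteq> UNIV}"
      by (rule finite_subset[OF _ I(1)]) auto
    have "openin ?P ?W"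
      unfolding openin_PiE_gen using fin by auto
    moreover have "z \<in> ?W" using z closure_of_subset_topspace[of ?P "Omega A"] by (auto simp: PiE_iff)
    ultimately obtain u where "u \<in> Omega A" "u \<in> ?W" using z unfolding in_closure_of by meson
    then show ?thesis using I(2) by (intro bexI[of _ u]) (auto simp: PiE_iff split: if_splits)
  qed
  have "z \<in> Omega A" if z: "z \<in> ?P closure_of Omega A" for z
  proof -
    have ext: "z \<in> extensional (tests A)"
      using z closure_of_subset_topspace[of ?P "Omega A"] by (auto simp: PiE_iff)
    have "z (T, f) \<in> fm_car T" if "(T, f) \<in> tests A" for T f
      using agree[OF z, of "{(T, f)}"] that Omega_in by fastforce
    moreover have "h (z (T, f)) = z (T', restrict (h \<circ> f) A)"
      if t: "(T, f) \<in> tests A" "finite_monoid T'" "fm_hom h T T'" for T f T' h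
    proof -
      obtain u where "u \<in> Omega A" "u (T, f) = z (T, f)" "u (T', restrict (h \<circ> f) A) = z (T', restrict (h \<circ> f) A)"
        using agree[OF z, of "{(T, f), (T', restrict (h \<circ> f) A)}"] tests_hom[OF t] t(1) by auto
      then show ?thesis using Omega_hom[OF _ t, of u] by simp
    qed
    ultimately show ?thesis unfolding Omega_def using ext by blast
  qed
  then have "closedin ?P (Omega A)"
    using Omega_subset_PiE[of A] by (intro closure_of_subset_eq[THEN iffD1]) auto
  moreover have "compactin ?P (Pi\<^sub>E (tests A) (\<lambda>p. fm_car (fst p)))"
    unfolding compactin_PiE by (simp add: compactin_discrete_topology)
  moreover have "Omega A \<subseteq> Pi\<^sub>E (tests A) (\<lambda>p. fm_car (fst p))"
  proof
    fix u assume u: "u \<in> Omega A"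
    then have "u p \<in> fm_car (fst p)" if "p \<in> tests A" for p
      using Omega_in[OF u, of "fst p" "snd p"] that by simp
    then show "u \<in> Pi\<^sub>E (tests A) (\<lambda>p. fm_car (fst p))" using Omega_ext[OF u] by (simp add: PiE_iff)
  qed
  ultimately have "compactin ?P (Omega A)" by (meson closed_compactin)
  then show ?thesis unfolding OmTop_def by (simp add: compactin_subspace)
qed

lemma continuous_map_om_mul_left:
  assumes "w \<in> Omega A" shows "continuous_map (OmTop A) (OmTop A) (om_mul A w)"
proof (rule continuous_map_into_OmTop)
  fix p assume p: "p \<in> tests A"
  show "continuous_map (OmTop A) (discrete_topology UNIV) (\<lambda>u. om_mul A w u p)"
    using continuous_map_discrete_comp[OF continuous_map_OmTop_apply[OF p], of "fm_mul (fst p) (w p)"]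
    by (simp add: om_mul_apply p)
qed (simp add: assms)

lemma continuous_map_om_mul_right:
  assumes "w \<in> Omega A" shows "continuous_map (OmTop A) (OmTop A) (\<lambda>u. om_mul A u w)"
proof (rule continuous_map_into_OmTop)
  fix p assume p: "p \<in> tests A"
  show "continuous_map (OmTop A) (discrete_topology UNIV) (\<lambda>u. om_mul A u w p)"
    using continuous_map_discrete_comp[OF continuous_map_OmTop_apply[OF p], of "\<lambda>x. fm_mul (fst p) x (w p)"]
    by (simp add: om_mul_apply p)
qed (simp add: assms)

text \<open>Factorial powers are eventually constant at each test, and the pointwise limit is
  natural because homomorphisms commute with \<open>fm_omega\<close>. Uniqueness of limits then
  justifies the description operator in \<open>om_omega\<close>.\<close>

lemma limitin_om_omega:
  assumes u: "u \<in> Omega A"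
  shows "limitin (OmTop A) (\<lambda>n. om_pow A u (fact n)) (om_omega A u) sequentially"
proof -
  let ?l = "restrict (\<lambda>p. fm_omega (fst p) (u (fst p, snd p))) (tests A)"
  have "?l \<in> Omega A"
  proof (rule OmegaI)
    fix T f assume t: "(T, f) \<in> tests A"
    then show "fm_omega T (u (T, f)) \<in> fm_car T"
      using u by (simp add: Omega_in fm_omega(2) testsD(1))
    fix T' h assume h: "finite_monoid T'" "fm_hom h T T'"
    show "h (fm_omega T (u (T, f))) = fm_omega T' (u (T', restrict (h \<circ> f) A))"
      unfolding Omega_hom[OF u t h, symmetric]
      by (rule fm_hom_omega[OF testsD(1)[OF t] h Omega_in[OF u t]])
  qed
  moreover have ev: "\<forall>\<^sub>F n in sequentially. om_pow A u (fact n) p = ?l p" if "p \<in> tests A" for p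
    using fm_omega(1)[of "fst p" "u p"] that Omega_in[OF u, of "fst p" "snd p"] testsD(1)[of "fst p" "snd p" A]
    by (simp add: om_pow_apply[OF u that])
  then have lim: "limitin (discrete_topology UNIV) (\<lambda>n. om_pow A u (fact n) p) (?l p) sequentially"
    if "p \<in> tests A" for p
    unfolding limitin_def by (auto intro: eventually_mono[OF ev[OF that]] simp del: restrict_apply)
  moreover have "om_pow A u (fact n) \<in> tests A \<rightarrow>\<^sub>E UNIV" for n
    using om_pow_in[OF u] Omega_subset_PiE by blast
  ultimately have lim': "limitin (OmTop A) (\<lambda>n. om_pow A u (fact n)) ?l sequentially"
    unfolding OmTop_def limitin_subtopology limitin_componentwise
    by (simp add: u del: restrict_apply)
  have "\<exists>!l. limitin (OmTop A) (\<lambda>n. om_pow A u (fact n)) l sequentially"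
  proof (rule ex1I)
    show "limitin (OmTop A) (\<lambda>n. om_pow A u (fact n)) ?l sequentially" by (rule lim')
    fix l assume "limitin (OmTop A) (\<lambda>n. om_pow A u (fact n)) l sequentially"
    then show "l = ?l" by (rule limitin_Hausdorff_unique[OF _ lim' _ Hausdorff_OmTop]) simp
  qed
  then show ?thesis unfolding om_omega_def by (rule theI')
qed

lemma om_omega_in [simp]: "u \<in> Omega A \<Longrightarrow> om_omega A u \<in> Omega A"
  using limitin_topspace[OF limitin_om_omega] by simp

section \<open>Provability as a closed congruence\<close>

lemma term_eval_in: "(\<And>i. env i \<in> Omega A) \<Longrightarrow> term_eval A t env \<in> Omega A"
  unfolding term_eval_def by (induction t) simp_all

lemma term_eval_cong: "(\<And>i. i \<in> set t \<Longrightarrow> env i = env' i) \<Longrightarrow> term_eval A t env = term_eval A t env'"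
  unfolding term_eval_def by (induction t) simp_all

lemma term_eval_Cons: "term_eval A (i # t) env = om_mul A (env i) (term_eval A t env)"
  by (simp add: term_eval_def)

lemma term_eval_snoc:
  assumes "\<And>i. env i \<in> Omega A"
  shows "term_eval A (t @ [i]) env = om_mul A (term_eval A t env) (env i)"
proof (induction t)
  case Nil
  then show ?case using assms by (simp add: term_eval_def om_one_left om_one_right)
next
  case (Cons j t)
  then show ?case using assms term_eval_in[of env A t] by (simp add: term_eval_Cons om_assoc)
qed

lemma cont_hom_om_in: "cont_hom_om B A \<phi> \<Longrightarrow> u \<in> Omega B \<Longrightarrow> \<phi> u \<in> Omega A"
  unfolding cont_hom_om_def continuous_map_def by auto

lemma Sigma0I:
  assumes "(B, u, v) \<in> \<Sigma> \<or> (B, v, u) \<in> \<Sigma>" "cont_hom_om B A \<phi>" "\<forall>i. env i \<in> Omega A"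
  shows "(term_eval A t (env(0 := \<phi> u)), term_eval A t (env(0 := \<phi> v))) \<in> Sigma0 \<Sigma> A"
  unfolding Sigma0_def using assms by blast

lemma Sigma0E:
  assumes "p \<in> Sigma0 \<Sigma> A" "\<forall>e\<in>\<Sigma>. pseudoidentity e"
  shows "\<exists>t env \<phi> B u v. ((B, u, v) \<in> \<Sigma> \<or> (B, v, u) \<in> \<Sigma>) \<and> cont_hom_om B A \<phi> \<and>
    (\<forall>i. env i \<in> Omega A) \<and> \<phi> u \<in> Omega A \<and> \<phi> v \<in> Omega A \<and>
    p = (term_eval A t (env(0 := \<phi> u)), term_eval A t (env(0 := \<phi> v)))"
proof -
  obtain t env \<phi> B u v where *: "(B, u, v) \<in> \<Sigma> \<or> (B, v, u) \<in> \<Sigma>" "cont_hom_om B A \<phi>"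
    "\<And>i. env i \<in> Omega A" "p = (term_eval A t (env(0 := \<phi> u)), term_eval A t (env(0 := \<phi> v)))"
    using assms(1) unfolding Sigma0_def by blast
  then have "u \<in> Omega B" "v \<in> Omega B" using assms(2) unfolding pseudoidentity_def by fastforce+
  then show ?thesis using * cont_hom_om_in[OF *(2)] by blast
qed

text \<open>The outer factor \<open>w\<close> is assigned to a fresh variable \<open>j\<close>,
  which is put before or after the term. It must differ from 0, since variable 0 is overwritten by
  the substituted value.\<close>

lemma Sigma0_mul:
  assumes "(a, b) \<in> Sigma0 \<Sigma> A" "\<forall>e\<in>\<Sigma>. pseudoidentity e" "w \<in> Omega A"
  shows "(om_mul A w a, om_mul A w b) \<in> Sigma0 \<Sigma> A" "(om_mul A a w, om_mul A b w) \<in> Sigma0 \<Sigma> A"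
proof -
  obtain t env \<phi> B u v where *: "(B, u, v) \<in> \<Sigma> \<or> (B, v, u) \<in> \<Sigma>" "cont_hom_om B A \<phi>"
    "\<And>i. env i \<in> Omega A" "\<phi> u \<in> Omega A" "\<phi> v \<in> Omega A"
    and ab: "(a, b) = (term_eval A t (env(0 := \<phi> u)), term_eval A t (env(0 := \<phi> v)))"
    using Sigma0E[OF assms(1,2)] by (elim exE conjE) metis
  obtain j where "j \<notin> insert 0 (set t)" using ex_new_if_finite[of "insert 0 (set t)"] by auto
  then have j: "j \<noteq> 0" "j \<notin> set t" by auto
  define env' where "env' = env(j := w)"
  have env': "\<forall>i. env' i \<in> Omega A" using *(3) assms(3) by (simp add: env'_def)
  have ev: "term_eval A t (env'(0 := z)) = term_eval A t (env(0 := z))" for z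
    by (rule term_eval_cong) (use j in \<open>auto simp: env'_def\<close>)
  have left: "term_eval A (j # t) (env'(0 := z)) = om_mul A w (term_eval A t (env(0 := z)))" for z
    using j(1) by (simp add: term_eval_Cons ev) (simp add: env'_def)
  have right: "term_eval A (t @ [j]) (env'(0 := z)) = om_mul A (term_eval A t (env(0 := z))) w"
    if "z \<in> Omega A" for z
  proof -
    have "term_eval A (t @ [j]) (env'(0 := z)) = om_mul A (term_eval A t (env'(0 := z))) ((env'(0 := z)) j)"
      by (rule term_eval_snoc) (use env' that in simp)
    also have "\<dots> = om_mul A (term_eval A t (env(0 := z))) w"
      unfolding ev using j(1) by (simp add: env'_def)
    finally show ?thesis .
  qed
  show "(om_mul A w a, om_mul A w b) \<in> Sigma0 \<Sigma> A"
    using Sigma0I[OF *(1,2) env', of "j # t"] ab by (simp only: left prod.inject)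
  show "(om_mul A a w, om_mul A b w) \<in> Sigma0 \<Sigma> A"
    using Sigma0I[OF *(1,2) env', of "t @ [j]"] ab by (simp only: right[OF *(4)] right[OF *(5)] prod.inject)
qed

text \<open>In the closure case continuity puts the image of the closure inside the closure of the
  image. Only the base case depends on \<open>f\<close>; the intended instances are the one-sided
  translations.\<close>

lemma provable_map:
  assumes "continuous_map (OmTop A) (OmTop A) f"
    and base: "\<And>a b. (a, b) \<in> Sigma0 \<Sigma> A \<Longrightarrow> (f a, f b) \<in> provable \<Sigma> A"
    and "(a, b) \<in> provable \<Sigma> A"
  shows "(f a, f b) \<in> provable \<Sigma> A"
proof -
  let ?P = "prod_topology (OmTop A) (OmTop A)" and ?f = "\<lambda>(x, y). (f x, f y)"
  have cont: "continuous_map ?P ?P ?f"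
    using assms(1) by (simp add: continuous_map_prod_top)
  have "?f p \<in> provable \<Sigma> A" if "p \<in> provable \<Sigma> A" for p
    using that
  proof (induction rule: provable.induct)
    case (base p)
    then show ?case using assms(2) by (cases p) simp
  next
    case (trans u v w)
    then show ?case using provable.trans[of "f u" "f v" \<Sigma> A "f w"] by simp
  next
    case (closure p)
    then have "?f p \<in> ?f ` (?P closure_of {x. x \<in> provable \<Sigma> A \<and> ?f x \<in> provable \<Sigma> A})" by blast
    also have "\<dots> \<subseteq> ?P closure_of (?f ` {x. x \<in> provable \<Sigma> A \<and> ?f x \<in> provable \<Sigma> A})"
      by (rule continuous_map_image_closure_subset[OF cont])
    also have "\<dots> \<subseteq> ?P closure_of (provable \<Sigma> A)" by (rule closure_of_mono) blast
    finally show ?case by (rule provable.closure)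
  qed
  then show ?thesis using assms(3) by fastforce
qed

text \<open>\<open>Sigma0\<close> admits both orientations of each pseudoidentity, and swapping the
  coordinates is a homeomorphism, so each rule is symmetric.\<close>

lemma provable_sym:
  assumes "(a, b) \<in> provable \<Sigma> A"
  shows "(b, a) \<in> provable \<Sigma> A"
proof -
  let ?P = "prod_topology (OmTop A) (OmTop A)" and ?f = "\<lambda>(x, y). (y, x)"
  have cont: "continuous_map ?P ?P ?f"
    by (rule homeomorphic_imp_continuous_map[OF homeomorphic_map_swap])
  have "?f p \<in> provable \<Sigma> A" if "p \<in> provable \<Sigma> A" for p
    using that
  proof (induction rule: provable.induct)
    case (base p)
    then obtain t env \<phi> B u v where *: "(B, v, u) \<in> \<Sigma> \<or> (B, u, v) \<in> \<Sigma>" "cont_hom_om B A \<phi>"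
      "\<forall>i. env i \<in> Omega A" "p = (term_eval A t (env(0 := \<phi> u)), term_eval A t (env(0 := \<phi> v)))"
      unfolding Sigma0_def by blast
    show ?case using Sigma0I[OF *(1-3), of t] *(4) by (simp add: provable.base)
  next
    case (trans u v w)
    then show ?case using provable.trans[of w v \<Sigma> A u] by simp
  next
    case (closure p)
    then have "?f p \<in> ?f ` (?P closure_of {x. x \<in> provable \<Sigma> A \<and> ?f x \<in> provable \<Sigma> A})" by blast
    also have "\<dots> \<subseteq> ?P closure_of (?f ` {x. x \<in> provable \<Sigma> A \<and> ?f x \<in> provable \<Sigma> A})"
      by (rule continuous_map_image_closure_subset[OF cont])
    also have "\<dots> \<subseteq> ?P closure_of (provable \<Sigma> A)" by (rule closure_of_mono) blast
    finally show ?case by (rule provable.closure)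
  qed
  then show ?thesis using assms by fastforce
qed

lemma provable_subset:
  assumes "\<forall>e\<in>\<Sigma>. pseudoidentity e"
  shows "provable \<Sigma> A \<subseteq> Omega A \<times> Omega A"
proof
  fix p assume "p \<in> provable \<Sigma> A"
  then show "p \<in> Omega A \<times> Omega A"
  proof (induction rule: provable.induct)
    case (base p)
    then obtain t env u v and \<phi> :: "pt \<Rightarrow> pt" where "\<And>i. env i \<in> Omega A" "\<phi> u \<in> Omega A" "\<phi> v \<in> Omega A"
      "p = (term_eval A t (env(0 := \<phi> u)), term_eval A t (env(0 := \<phi> v)))"
      using Sigma0E[OF base assms] by (elim exE conjE) metis
    then show ?case by (simp add: term_eval_in)
  next
    case (closure p)
    then show ?case
      using closure_of_subset_topspace[of "prod_topology (OmTop A) (OmTop A)"] by fastforce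
  qed auto
qed

lemma closedin_provable:
  assumes "\<forall>e\<in>\<Sigma>. pseudoidentity e"
  shows "closedin (prod_topology (OmTop A) (OmTop A)) (provable \<Sigma> A)"
proof (rule closure_of_subset_eq[THEN iffD1], intro conjI)
  show "provable \<Sigma> A \<subseteq> topspace (prod_topology (OmTop A) (OmTop A))"
    using provable_subset[OF assms] by simp
  show "prod_topology (OmTop A) (OmTop A) closure_of provable \<Sigma> A \<subseteq> provable \<Sigma> A"
    by (rule subsetI) (rule provable.closure)
qed

text \<open>The factors are exchanged one at a time, passing through
  \<open>om_mul A b c\<close>.\<close>

lemma provable_mul:
  assumes "\<forall>e\<in>\<Sigma>. pseudoidentity e"
    and "(a, b) \<in> provable \<Sigma> A" "(c, d) \<in> provable \<Sigma> A"
  shows "(om_mul A a c, om_mul A b d) \<in> provable \<Sigma> A"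
proof -
  have in_Omega: "a \<in> Omega A" "b \<in> Omega A" "c \<in> Omega A" "d \<in> Omega A"
    using provable_subset[OF assms(1), of A] assms(2,3) by auto
  have "(om_mul A a c, om_mul A b c) \<in> provable \<Sigma> A"
    by (rule provable_map[OF continuous_map_om_mul_right[OF in_Omega(3)] _ assms(2)])
      (rule provable.base[OF Sigma0_mul(2)[OF _ assms(1) in_Omega(3)]])
  moreover have "(om_mul A b c, om_mul A b d) \<in> provable \<Sigma> A"
    by (rule provable_map[OF continuous_map_om_mul_left[OF in_Omega(2)] _ assms(3)])
      (rule provable.base[OF Sigma0_mul(1)[OF _ assms(1) in_Omega(2)]])
  ultimately show ?thesis by (rule provable.trans)
qed

lemma provable_subst:
  assumes "(B, u, v) \<in> \<Sigma>" "cont_hom_om B A \<phi>" "\<phi> u \<in> Omega A" "\<phi> v \<in> Omega A"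
  shows "(\<phi> u, \<phi> v) \<in> provable \<Sigma> A"
  using provable.base[OF Sigma0I[of B u v \<Sigma> A \<phi> "\<lambda>_. om_one A" "[0]"]] assms
  by (simp add: term_eval_def om_one_right)

text \<open>Reflexivity is not among the rules. It comes from the term consisting of variable 1
  alone, on which the substitution at variable 0 has no effect.\<close>

lemma provable_refl:
  assumes "(B, u, v) \<in> \<Sigma>" "cont_hom_om B A \<phi>" "w \<in> Omega A"
  shows "(w, w) \<in> provable \<Sigma> A"
  using provable.base[OF Sigma0I[of B u v \<Sigma> A \<phi> "\<lambda>_. w" "[1]"]] assms
  by (simp add: term_eval_def om_one_right)

section \<open>Words and finite quotients\<close>

definition wev :: "fm \<Rightarrow> (nat \<Rightarrow> nat) \<Rightarrow> nat list \<Rightarrow> nat" where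
  "wev T f w = foldr (\<lambda>a. fm_mul T (f a)) w (fm_one T)"

lemma wev_simps [simp]: "wev T f [] = fm_one T" "wev T f (a # w) = fm_mul T (f a) (wev T f w)"
  by (simp_all add: wev_def)

lemma tests_app: "(T, f) \<in> tests A \<Longrightarrow> a \<in> A \<Longrightarrow> f a \<in> fm_car T"
  using testsD(2) by blast

lemma wev_in:
  assumes "(T, f) \<in> tests A" "w \<in> lists A" shows "wev T f w \<in> fm_car T"
  using assms(2) by (induction w) (auto simp: fm_one_in fm_mul_in testsD(1)[OF assms(1)] tests_app[OF assms(1)])

lemma wev_append:
  assumes "(T, f) \<in> tests A" "u \<in> lists A" "v \<in> lists A"
  shows "wev T f (u @ v) = fm_mul T (wev T f u) (wev T f v)"
  using assms(2)
proof (induction u)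
  case Nil
  then show ?case using wev_in[OF assms(1,3)] testsD(1)[OF assms(1)] by (simp add: fm_one_left)
next
  case (Cons a u)
  then show ?case
    using wev_in[OF assms(1)] testsD(1)[OF assms(1)] tests_app[OF assms(1)] assms(3) by (simp add: fm_assoc)
qed

lemma wev_wpow:
  assumes "(T, f) \<in> tests A" "w \<in> lists A"
  shows "wev T f (wpow n w) = fm_pow T (wev T f w) n"
  by (induction n) (simp_all add: fm_pow_def wev_append[OF assms(1)] assms(2))

text \<open>The classes are numbered by \<open>e\<close> because the carrier of an \<open>fm\<close>
  is an initial segment of the naturals; multiplication concatenates chosen representatives.\<close>

lemma word_quotient:
  fixes K :: "nat list \<Rightarrow> 'a"
  assumes fin: "finite (K ` lists B)"
    and cong: "\<forall>w\<in>lists B. \<forall>w'\<in>lists B. \<forall>u\<in>lists B. \<forall>v\<in>lists B.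
      K w = K w' \<longrightarrow> K (u @ w @ v) = K (u @ w' @ v)"
  shows "\<exists>N f. (N, f) \<in> tests B \<and> fm_car N = wev N f ` lists B \<and>
    (\<forall>w\<in>lists B. \<forall>w'\<in>lists B. wev N f w = wev N f w' \<longleftrightarrow> K w = K w')"
proof -
  obtain e where e: "bij_betw e (K ` lists B) {0..<card (K ` lists B)}"
    using ex_bij_betw_finite_nat[OF fin] by blast
  define \<nu> where "\<nu> w = e (K w)" for w
  define rep where "rep x = (SOME w. w \<in> lists B \<and> \<nu> w = x)" for x
  have \<nu>_eq: "\<nu> w = \<nu> w' \<longleftrightarrow> K w = K w'" if "w \<in> lists B" "w' \<in> lists B" for w w'
    using bij_betw_imp_inj_on[OF e] that unfolding \<nu>_def by (auto dest: inj_onD)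
  have rep: "rep (\<nu> w) \<in> lists B \<and> \<nu> (rep (\<nu> w)) = \<nu> w" if "w \<in> lists B" for w
    unfolding rep_def using that by (intro someI[of "\<lambda>v. v \<in> lists B \<and> \<nu> v = \<nu> w" w]) simp
  define N :: fm where "N = (card (K ` lists B), (\<lambda>x y. \<nu> (rep x @ rep y)), \<nu> [])"
  define f where "f = restrict (\<lambda>b. \<nu> [b]) B"
  have car: "fm_car N = \<nu> ` lists B"
    using bij_betw_imp_surj_on[OF e] by (simp add: N_def fm_car_def \<nu>_def image_image lessThan_atLeast0)
  have one: "fm_one N = \<nu> []" by (simp add: N_def fm_one_def)
  have mul: "fm_mul N (\<nu> u) (\<nu> v) = \<nu> (u @ v)" if "u \<in> lists B" "v \<in> lists B" for u v
  proof -
    have "K (rep (\<nu> u)) = K u" "K (rep (\<nu> v)) = K v"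
      using \<nu>_eq[of "rep (\<nu> u)" u] \<nu>_eq[of "rep (\<nu> v)" v] rep that by blast+
    then have "K (rep (\<nu> u) @ rep (\<nu> v)) = K (u @ rep (\<nu> v))" "K (u @ rep (\<nu> v)) = K (u @ v)"
      using cong[rule_format, of "rep (\<nu> u)" u "[]" "rep (\<nu> v)"]
        cong[rule_format, of "rep (\<nu> v)" v u "[]"] rep that by auto
    then show ?thesis by (simp add: N_def fm_mul_def \<nu>_def)
  qed
  have "finite_monoid N"
    unfolding finite_monoid_def car by (auto simp: one mul intro!: imageI simp del: lists_eq_set)
  moreover have "f \<in> B \<rightarrow>\<^sub>E fm_car N" unfolding car f_def by auto
  ultimately have t: "(N, f) \<in> tests B" by (simp add: tests_def)
  have wev: "wev N f w = \<nu> w" if "w \<in> lists B" for w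
    using that
  proof (induction w)
    case (Cons b w)
    then have "fm_mul N (\<nu> [b]) (\<nu> w) = \<nu> ([b] @ w)" by (intro mul) simp_all
    then show ?case using Cons by (simp add: f_def)
  qed (simp add: one)
  have "fm_car N = wev N f ` lists B" unfolding car by (rule image_cong[OF refl]) (simp only: wev)
  then show ?thesis using t by (intro exI[of _ N] exI[of _ f]) (simp add: wev \<nu>_eq)
qed

text \<open>\<open>N\<close> is the submonoid generated by the letters in the product of the tests
  in \<open>I\<close>, realised as words modulo equal values in all of them. The projections are
  homomorphisms, so by naturality the value of an operation in \<open>N\<close> determines its
  values at all tests in \<open>I\<close>.\<close>

lemma joint_test:
  assumes "finite I" "I \<subseteq> tests B"
  shows "\<exists>N f. (N, f) \<in> tests B \<and> fm_car N = wev N f ` lists B \<and>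
    (\<forall>u\<in>Omega B. \<forall>w\<in>lists B. u (N, f) = wev N f w \<longrightarrow> (\<forall>T g. (T, g) \<in> I \<longrightarrow> u (T, g) = wev T g w))"
proof -
  define K where "K w = restrict (\<lambda>p. wev (fst p) (snd p) w) I" for w
  have Kw: "wev T g w = wev T g w'" if "K w = K w'" "(T, g) \<in> I" for T g w w'
    using fun_cong[OF that(1), of "(T, g)"] that(2) by (simp add: K_def)
  have wI: "wev (fst p) (snd p) w \<in> fm_car (fst p)" if "p \<in> I" "w \<in> lists B" for p w
    using wev_in[of "fst p" "snd p" B w] that assms(2) by auto
  then have "K ` lists B \<subseteq> (\<Pi>\<^sub>E p\<in>I. fm_car (fst p))"
    unfolding K_def by (intro image_subsetI restrict_PiE_iff[THEN iffD2] ballI)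
  then have "finite (K ` lists B)"
    by (rule finite_subset) (intro finite_PiE assms(1) finite_fm_car)
  moreover have K_cong: "K (u @ w @ v) = K (u @ w' @ v)"
    if "w \<in> lists B" "w' \<in> lists B" "u \<in> lists B" "v \<in> lists B" "K w = K w'" for w w' u v
    unfolding K_def
  proof (rule restrict_ext)
    fix p assume p: "p \<in> I"
    then have t: "(fst p, snd p) \<in> tests B" using assms(2) by auto
    show "wev (fst p) (snd p) (u @ w @ v) = wev (fst p) (snd p) (u @ w' @ v)"
      using Kw[OF that(5), of "fst p" "snd p"] p that(1-4) by (simp add: wev_append[OF t])
  qed
  ultimately have "\<exists>N f. (N, f) \<in> tests B \<and> fm_car N = wev N f ` lists B \<and>
      (\<forall>w\<in>lists B. \<forall>w'\<in>lists B. wev N f w = wev N f w' \<longleftrightarrow> K w = K w')"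
    by (intro word_quotient) blast+
  then obtain N f where t: "(N, f) \<in> tests B" and car: "fm_car N = wev N f ` lists B"
    and eq: "\<forall>w\<in>lists B. \<forall>w'\<in>lists B. wev N f w = wev N f w' \<longleftrightarrow> K w = K w'"
    by blast
  have "u (T, g) = wev T g w"
    if u: "u \<in> Omega B" and w: "w \<in> lists B" and uw: "u (N, f) = wev N f w" and I: "(T, g) \<in> I" for u w T g
  proof -
    have tT: "(T, g) \<in> tests B" using I assms(2) by blast
    \<comment> \<open>This is the projection of \<open>N\<close> to \<open>T\<close>, computed on
      any word that represents \<open>x\<close>.\<close>
    define h where "h x = wev T g (SOME w. w \<in> lists B \<and> wev N f w = x)" for x
    have h: "h (wev N f w) = wev T g w" if "w \<in> lists B" for w
    proof -
      let ?v = "SOME v. v \<in> lists B \<and> wev N f v = wev N f w"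
      have v: "?v \<in> lists B \<and> wev N f ?v = wev N f w"
        using that by (intro someI[of "\<lambda>v. v \<in> lists B \<and> wev N f v = wev N f w" w]) simp
      then have "K ?v = K w" using eq that by blast
      then show ?thesis unfolding h_def using Kw[OF _ I] by blast
    qed
    have "fm_hom h N T"
      unfolding fm_hom_def
    proof (intro conjI ballI)
      fix x assume "x \<in> fm_car N"
      then obtain v where v: "v \<in> lists B" "x = wev N f v" unfolding car by blast
      show "h x \<in> fm_car T" unfolding v(2) h[OF v(1)] by (rule wev_in[OF tT v(1)])
    next
      fix x y assume "x \<in> fm_car N" "y \<in> fm_car N"
      then obtain v w where "v \<in> lists B" "x = wev N f v" "w \<in> lists B" "y = wev N f w"
        unfolding car by blast
      then show "h (fm_mul N x y) = fm_mul T (h x) (h y)"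
        using h[of "v @ w"] h[of v] h[of w] wev_append[OF t] wev_append[OF tT] by simp
    next
      show "h (fm_one N) = fm_one T" using h[of "[]"] by simp
    qed
    moreover have "restrict (h \<circ> f) B = g"
    proof
      fix b
      show "restrict (h \<circ> f) B b = g b"
      proof (cases "b \<in> B")
        case True
        have single: "wev N f [b] = f b" "wev T g [b] = g b"
          using tests_app[OF t True] tests_app[OF tT True] testsD(1)[OF t] testsD(1)[OF tT]
          by (simp_all add: fm_one_right)
        have "h (wev N f [b]) = wev T g [b]" by (rule h) (simp add: True)
        then show ?thesis unfolding single using True by simp
      next
        case False
        then show ?thesis using PiE_arb[OF testsD(2)[OF tT] False] by simp
      qed
    qed
    ultimately have "h (u (N, f)) = u (T, g)" using Omega_hom[OF u t testsD(1)[OF tT], of h] by simp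
    then show ?thesis unfolding uw h[OF w] by (rule sym)
  qed
  then show ?thesis using t car by (intro exI[of _ N] exI[of _ f]) blast
qed

lemma words_dense:
  assumes "finite I" "I \<subseteq> tests B" "u \<in> Omega B"
  obtains w where "w \<in> lists B" "\<forall>T g. (T, g) \<in> I \<longrightarrow> u (T, g) = wev T g w"
proof -
  obtain N f where N: "(N, f) \<in> tests B" "fm_car N = wev N f ` lists B" and
    I: "\<forall>u\<in>Omega B. \<forall>w\<in>lists B. u (N, f) = wev N f w \<longrightarrow> (\<forall>T g. (T, g) \<in> I \<longrightarrow> u (T, g) = wev T g w)"
    using joint_test[OF assms(1,2)] by blast
  obtain w where w: "w \<in> lists B" "u (N, f) = wev N f w"
    using Omega_in[OF assms(3) N(1)] N(2) by blast
  show ?thesis using that[OF w(1)] I assms(3) w by blast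
qed

section \<open>Aperiodic models, evaluations and substitutions\<close>

lemma fm_pow_Suc_right:
  assumes "finite_monoid T" "x \<in> fm_car T"
  shows "fm_mul T (fm_pow T x n) x = fm_pow T x (Suc n)"
proof (induction n)
  case 0
  then show ?case using assms by (simp add: fm_pow_def fm_one_left fm_one_right)
next
  case (Suc n)
  have "fm_mul T (fm_pow T x (Suc n)) x = fm_mul T x (fm_mul T (fm_pow T x n) x)"
    using assms fm_pow_in[OF assms] by (simp add: fm_pow_def fm_assoc)
  then show ?case unfolding Suc by (simp add: fm_pow_def)
qed

lemma om_pow_Suc_right:
  assumes "u \<in> Omega A"
  shows "om_mul A (om_pow A u n) u = om_pow A u (Suc n)"
proof (rule Omega_eqI[of _ A])
  fix T f assume t: "(T, f) \<in> tests A"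
  show "om_mul A (om_pow A u n) u (T, f) = om_pow A u (Suc n) (T, f)"
    using fm_pow_Suc_right[OF testsD(1)[OF t] Omega_in[OF assms t]]
    by (simp add: om_mul_apply om_pow_apply t assms)
qed (simp_all add: assms)

lemma aperiodic_holds_in:
  assumes N: "finite_monoid N" and ap: "\<And>x. x \<in> fm_car N \<Longrightarrow> \<exists>n. \<forall>m\<ge>n. fm_pow N x m = fm_pow N x (Suc m)"
    and u: "u \<in> Omega B"
  shows "holds_in N (B, om_omega_plus1 B u, om_omega B u)"
  unfolding holds_in_def prod.case
proof (intro allI impI)
  fix \<psi> assume \<psi>: "cont_hom_fm B N \<psi>"
  then have cont: "continuous_map (OmTop B) (discrete_topology (fm_car N)) \<psi>"
    and mul: "\<And>u v. u \<in> Omega B \<Longrightarrow> v \<in> Omega B \<Longrightarrow> \<psi> (om_mul B u v) = fm_mul N (\<psi> u) (\<psi> v)"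
    and one: "\<psi> (om_one B) = fm_one N"
    unfolding cont_hom_fm_def by auto
  have x: "\<psi> u \<in> fm_car N" using cont u unfolding continuous_map_def by auto
  have pow: "\<psi> (om_pow B u n) = fm_pow N (\<psi> u) n" for n
    by (induction n) (simp add: om_pow_def fm_pow_def one, simp add: om_pow_Suc fm_pow_def mul u)
  have "limitin (discrete_topology (fm_car N)) (\<psi> \<circ> (\<lambda>n. om_pow B u (fact n))) (\<psi> (om_omega B u)) sequentially"
    by (rule continuous_map_limit[OF cont limitin_om_omega[OF u]])
  then have "\<psi> (om_omega B u) \<in> fm_car N"
    "\<forall>U. U \<subseteq> fm_car N \<and> \<psi> (om_omega B u) \<in> U \<longrightarrow> (\<forall>\<^sub>F n in sequentially. \<psi> (om_pow B u (fact n)) \<in> U)"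
    unfolding limitin_def by simp_all
  then have "\<forall>\<^sub>F n in sequentially. fm_pow N (\<psi> u) (fact n) \<in> {\<psi> (om_omega B u)}"
    unfolding pow by blast
  then obtain n\<^sub>1 where n1: "\<And>n. n \<ge> n\<^sub>1 \<Longrightarrow> fm_pow N (\<psi> u) (fact n) = \<psi> (om_omega B u)"
    unfolding eventually_sequentially by blast
  obtain n\<^sub>2 where n2: "\<And>m. m \<ge> n\<^sub>2 \<Longrightarrow> fm_pow N (\<psi> u) m = fm_pow N (\<psi> u) (Suc m)"
    using ap[OF x] by blast
  \<comment> \<open>Since \<open>m\<close> is at most its factorial, \<open>fact m\<close> is both
    an exponent that computes the omega power and one in the stationary range.\<close>
  define m where "m = max n\<^sub>1 n\<^sub>2"
  have "n\<^sub>2 \<le> fact m" using fact_ge_self[of m] by (simp add: m_def)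
  note n2' = n2[OF this]
  have m1: "fm_pow N (\<psi> u) (fact m) = \<psi> (om_omega B u)" by (rule n1) (simp add: m_def)
  have "\<psi> (om_omega_plus1 B u) = fm_mul N (\<psi> (om_omega B u)) (\<psi> u)"
    unfolding om_omega_plus1_def using u by (simp add: mul)
  also have "\<dots> = fm_pow N (\<psi> u) (Suc (fact m))"
    unfolding m1[symmetric] by (rule fm_pow_Suc_right[OF N x])
  also have "\<dots> = \<psi> (om_omega B u)" using n2' m1 by simp
  finally show "\<psi> (om_omega_plus1 B u) = \<psi> (om_omega B u)" .
qed

text \<open>This instance turns validity in a monoid into equality of the values of both sides at
  each test on it.\<close>

lemma cont_hom_fm_eval:
  assumes t: "(T, f) \<in> tests B"
  shows "cont_hom_fm B T (\<lambda>u. u (T, f))"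
  unfolding cont_hom_fm_def
proof (intro conjI ballI)
  have "continuous_map (OmTop B) (subtopology (discrete_topology UNIV) (fm_car T)) (\<lambda>u. u (T, f))"
    unfolding continuous_map_in_subtopology
    using continuous_map_OmTop_apply[OF t] Omega_in[OF _ t] by auto
  then show "continuous_map (OmTop B) (discrete_topology (fm_car T)) (\<lambda>u. u (T, f))"
    by simp
qed (simp_all add: om_mul_apply om_one_apply t)

text \<open>The substitution evaluates a one-letter operation at the value that \<open>g\<close>
  takes at the given test; naturality of \<open>g\<close> makes the result natural.\<close>

lemma cont_hom_om_subst:
  assumes g: "g \<in> Omega A"
  obtains \<phi> where "cont_hom_om {0} A \<phi>" "\<phi> (om_gen {0} 0) = g"
proof -
  define c where "c x = restrict (\<lambda>_::nat. x) {0}" for x :: nat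
  have c: "(T, c (g (T, f))) \<in> tests {0}" if "(T, f) \<in> tests A" for T f
    using testsD(1)[OF that] Omega_in[OF g that] by (simp add: tests_def c_def)
  define \<phi> where "\<phi> v = restrict (\<lambda>p. v (fst p, c (g (fst p, snd p)))) (tests A)" for v :: pt
  have in_Omega: "\<phi> v \<in> Omega A" if v: "v \<in> Omega {0}" for v
    unfolding \<phi>_def
  proof (rule OmegaI)
    fix T f assume t: "(T, f) \<in> tests A"
    show "v (T, c (g (T, f))) \<in> fm_car T" by (rule Omega_in[OF v c[OF t]])
    fix T' h assume h: "finite_monoid T'" "fm_hom h T T'"
    have "restrict (h \<circ> c (g (T, f))) {0} = c (g (T', restrict (h \<circ> f) A))"
      unfolding Omega_hom[OF g t h, symmetric] by (auto simp: c_def)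
    then show "h (v (T, c (g (T, f)))) = v (T', c (g (T', restrict (h \<circ> f) A)))"
      using Omega_hom[OF v c[OF t] h] by simp
  qed
  have "continuous_map (OmTop {0}) (OmTop A) \<phi>"
  proof (rule continuous_map_into_OmTop)
    fix p assume p: "p \<in> tests A"
    then have "(fst p, c (g (fst p, snd p))) \<in> tests {0}" using c[of "fst p" "snd p"] by simp
    from continuous_map_OmTop_apply[OF this]
    show "continuous_map (OmTop {0}) (discrete_topology UNIV) (\<lambda>v. \<phi> v p)"
      using p by (simp add: \<phi>_def)
  qed (simp add: in_Omega)
  moreover have "\<phi> (om_mul {0} u v) = om_mul A (\<phi> u) (\<phi> v)" if "u \<in> Omega {0}" "v \<in> Omega {0}" for u v
    by (rule Omega_eqI[of _ A]) (use that c in \<open>simp_all add: in_Omega om_mul_apply\<close>, simp add: \<phi>_def om_mul_apply)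
  moreover have "\<phi> (om_one {0}) = om_one A"
    by (rule Omega_eqI[of _ A]) (use c in \<open>simp_all add: in_Omega om_one_apply\<close>, simp add: \<phi>_def om_one_apply)
  ultimately have "cont_hom_om {0} A \<phi>" unfolding cont_hom_om_def by blast
  moreover have "\<phi> (om_gen {0} 0) = g"
  proof (rule Omega_eqI[OF _ g])
    fix T f assume "(T, f) \<in> tests A"
    then show "\<phi> (om_gen {0} 0) (T, f) = g (T, f)"
      using c[of T f] by (simp add: \<phi>_def om_gen_def) (simp add: c_def)
  qed (simp add: in_Omega om_gen_in)
  ultimately show ?thesis by (rule that)
qed

lemma cont_hom_om_omega:
  assumes \<phi>: "cont_hom_om B A \<phi>" and u: "u \<in> Omega B"
  shows "\<phi> (om_omega B u) = om_omega A (\<phi> u)"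
proof -
  have cont: "continuous_map (OmTop B) (OmTop A) \<phi>"
    and mul: "\<And>u v. u \<in> Omega B \<Longrightarrow> v \<in> Omega B \<Longrightarrow> \<phi> (om_mul B u v) = om_mul A (\<phi> u) (\<phi> v)"
    and one: "\<phi> (om_one B) = om_one A"
    using \<phi> unfolding cont_hom_om_def by auto
  have pow: "\<phi> (om_pow B u n) = om_pow A (\<phi> u) n" for n
    by (induction n) (simp add: om_pow_def one, simp add: om_pow_Suc mul u)
  have "limitin (OmTop A) (\<phi> \<circ> (\<lambda>n. om_pow B u (fact n))) (\<phi> (om_omega B u)) sequentially"
    by (rule continuous_map_limit[OF cont limitin_om_omega[OF u]])
  then have "limitin (OmTop A) (\<lambda>n. om_pow A (\<phi> u) (fact n)) (\<phi> (om_omega B u)) sequentially"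
    by (simp add: o_def pow)
  then show ?thesis
    by (rule limitin_Hausdorff_unique[OF _ limitin_om_omega[OF cont_hom_om_in[OF \<phi> u]] _ Hausdorff_OmTop]) simp
qed

section \<open>Good sets\<close>

definition smul :: "fm \<Rightarrow> nat set \<Rightarrow> nat set \<Rightarrow> nat set" where
  "smul T X Y = {fm_mul T x y | x y. x \<in> X \<and> y \<in> Y}"

text \<open>The value outside the subsets of the carrier is chosen such that \<^term>\<open>rmul T {fm_one T}\<close> is
  the identity function.\<close>

definition rmul :: "fm \<Rightarrow> nat set \<Rightarrow> nat set \<Rightarrow> nat set" where
  "rmul T X Z = (if Z \<subseteq> fm_car T then smul T Z X else Z)"

lemma smul_mono: "X \<subseteq> X' \<Longrightarrow> Y \<subseteq> Y' \<Longrightarrow> smul T X Y \<subseteq> smul T X' Y'"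
  unfolding smul_def by blast

lemma smul_subset:
  assumes "finite_monoid T" "X \<subseteq> fm_car T" "Y \<subseteq> fm_car T" shows "smul T X Y \<subseteq> fm_car T"
  unfolding smul_def using fm_mul_in[OF assms(1)] assms(2,3) by blast

lemma smul_assoc:
  assumes "finite_monoid T" "X \<subseteq> fm_car T" "Y \<subseteq> fm_car T" "Z \<subseteq> fm_car T"
  shows "smul T (smul T X Y) Z = smul T X (smul T Y Z)"
proof -
  have assoc: "fm_mul T (fm_mul T x y) z = fm_mul T x (fm_mul T y z)" if "x \<in> X" "y \<in> Y" "z \<in> Z" for x y z
    using that assms(2-4) by (intro fm_assoc[OF assms(1)]) blast+
  have "smul T (smul T X Y) Z = (\<Union>x\<in>X. \<Union>y\<in>Y. \<Union>z\<in>Z. {fm_mul T (fm_mul T x y) z})"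
    unfolding smul_def by blast
  also have "\<dots> = (\<Union>x\<in>X. \<Union>y\<in>Y. \<Union>z\<in>Z. {fm_mul T x (fm_mul T y z)})"
    using assoc by (intro SUP_cong refl) simp
  also have "\<dots> = smul T X (smul T Y Z)"
    unfolding smul_def by blast
  finally show ?thesis .
qed

lemma smul_one:
  assumes "finite_monoid T" "X \<subseteq> fm_car T"
  shows "smul T X {fm_one T} = X" "smul T {fm_one T} X = X"
proof -
  have "fm_mul T x (fm_one T) = x" "fm_mul T (fm_one T) x = x" if "x \<in> X" for x
    using fm_one_right[OF assms(1)] fm_one_left[OF assms(1)] assms(2) that by blast+
  then show "smul T X {fm_one T} = X" "smul T {fm_one T} X = X"
    unfolding smul_def by force+
qed

lemma rmul_comp:
  assumes T: "finite_monoid T" and XY: "X \<subseteq> fm_car T" "Y \<subseteq> fm_car T"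
  shows "rmul T X \<circ> rmul T Y = rmul T (smul T Y X)"
proof
  fix Z
  show "(rmul T X \<circ> rmul T Y) Z = rmul T (smul T Y X) Z"
  proof (cases "Z \<subseteq> fm_car T")
    case True
    then show ?thesis
      using smul_subset[OF T True XY(2)] smul_assoc[OF T True XY(2,1)] by (simp add: rmul_def)
  qed (simp add: rmul_def)
qed

lemma rmul_one:
  assumes "finite_monoid T" shows "rmul T {fm_one T} = id"
proof
  show "rmul T {fm_one T} Z = id Z" for Z
    using smul_one(1)[OF assms, of Z] by (simp add: rmul_def)
qed

text \<open>The iterate applied to the singleton of the unit serves as the set power of
  \<open>X\<close>, so powers of the action and powers of sets are interchangeable.\<close>

lemma rmul_funpow:
  assumes T: "finite_monoid T" and X: "X \<subseteq> fm_car T"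
  shows "(rmul T X ^^ n) {fm_one T} \<subseteq> fm_car T \<and> (rmul T X ^^ n) = rmul T ((rmul T X ^^ n) {fm_one T})"
proof (induction n)
  case 0
  then show ?case using fm_one_in[OF T] rmul_one[OF T] by simp
next
  case (Suc n)
  let ?P = "(rmul T X ^^ n) {fm_one T}"
  from Suc have P: "?P \<subseteq> fm_car T" "rmul T X ^^ n = rmul T ?P" by (rule conjunct1, rule conjunct2)
  have *: "(rmul T X ^^ Suc n) {fm_one T} = smul T ?P X" using P(1) by (simp add: rmul_def)
  have "rmul T X ^^ Suc n = rmul T X \<circ> rmul T X ^^ n" by simp
  also have "\<dots> = rmul T X \<circ> rmul T ?P" by (rule arg_cong[OF P(2)])
  also have "\<dots> = rmul T (smul T ?P X)" by (rule rmul_comp[OF T X P(1)])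
  finally show ?case unfolding * using smul_subset[OF T P(1) X] by blast
qed

text \<open>These sets play the role of pointlike sets. The anchor \<open>g\<close> need not itself
  take a value in \<open>X\<close>: powers and limits are formed of \<open>g\<close> alone, while
  the witnesses \<open>w\<close> vary with the element.\<close>

definition good :: "pid set \<Rightarrow> nat set \<Rightarrow> tst \<Rightarrow> nat set \<Rightarrow> bool" where
  "good \<Sigma> A p X \<longleftrightarrow> (\<exists>g\<in>Omega A. \<forall>t\<in>X. \<exists>w. (w, g) \<in> provable \<Sigma> A \<and> w p = t)"

text \<open>Projections of closed sets need not be closed in general; here the fibre over
  \<open>t\<close> is compact, so its image in a Hausdorff space is closed. This is what allows
  witnesses to survive a limit of anchors.\<close>

lemma closedin_fibre_image:
  assumes R: "closedin (prod_topology (OmTop A) (OmTop A)) R" and p: "p \<in> tests A"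
  shows "closedin (OmTop A) {g. \<exists>w. (w, g) \<in> R \<and> w p = t}"
proof -
  let ?P = "prod_topology (OmTop A) (OmTop A)"
  have sub: "R \<subseteq> topspace ?P" using R by (rule closedin_subset)
  have "continuous_map ?P (discrete_topology UNIV) (\<lambda>q. fst q p)"
    using continuous_map_compose[OF continuous_map_fst continuous_map_OmTop_apply[OF p]]
    by (simp add: o_def)
  then have "closedin ?P {q \<in> topspace ?P. fst q p \<in> {t}}"
    by (rule closedin_continuous_map_preimage) simp
  then have "closedin ?P (R \<inter> {q \<in> topspace ?P. fst q p \<in> {t}})"
    using R by blast
  then have "compactin ?P (R \<inter> {q \<in> topspace ?P. fst q p \<in> {t}})"
    by (rule closedin_compact_space[rotated]) (simp add: compact_space_prod_topology compact_OmTop)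
  then have "compactin (OmTop A) (snd ` (R \<inter> {q \<in> topspace ?P. fst q p \<in> {t}}))"
    by (rule image_compactin) (rule continuous_map_snd)
  moreover have "snd ` (R \<inter> {q \<in> topspace ?P. fst q p \<in> {t}}) = {g. \<exists>w. (w, g) \<in> R \<and> w p = t}"
    using sub by force
  ultimately show ?thesis using compactin_imp_closedin[OF Hausdorff_OmTop] by simp
qed

definition \<Sigma>\<^sub>A :: "pid set" where
  "\<Sigma>\<^sub>A = {({0}, om_omega_plus1 {0} (om_gen {0} 0), om_omega {0} (om_gen {0} 0))}"

lemma pseudoidentity_\<Sigma>\<^sub>A: "\<forall>e\<in>\<Sigma>\<^sub>A. pseudoidentity e"
  by (simp add: \<Sigma>\<^sub>A_def pseudoidentity_def om_omega_plus1_def om_gen_in)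

lemma provable_omega:
  assumes g: "g \<in> Omega A"
  shows "(om_mul A (om_omega A g) g, om_omega A g) \<in> provable \<Sigma>\<^sub>A A"
proof -
  obtain \<phi> where \<phi>: "cont_hom_om {0} A \<phi>" "\<phi> (om_gen {0} 0) = g"
    by (rule cont_hom_om_subst[OF g])
  have x: "om_gen {0} 0 \<in> Omega {0}" by (simp add: om_gen_in)
  have om: "\<phi> (om_omega {0} (om_gen {0} 0)) = om_omega A g"
    using cont_hom_om_omega[OF \<phi>(1) x] \<phi>(2) by simp
  moreover have "\<phi> (om_omega_plus1 {0} (om_gen {0} 0)) = om_mul A (om_omega A g) g"
    using \<phi> x om unfolding om_omega_plus1_def cont_hom_om_def by simp
  ultimately show ?thesis
    using provable_subst[of "{0}" "om_omega_plus1 {0} (om_gen {0} 0)" "om_omega {0} (om_gen {0} 0)" \<Sigma>\<^sub>A A \<phi>] \<phi>(1) g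
    by (simp add: \<Sigma>\<^sub>A_def)
qed

lemma provable_\<Sigma>\<^sub>A_refl:
  assumes "w \<in> Omega A" shows "(w, w) \<in> provable \<Sigma>\<^sub>A A"
proof -
  obtain \<phi> where \<phi>: "cont_hom_om {0} A \<phi>" by (rule cont_hom_om_subst[OF assms])
  show ?thesis by (rule provable_refl[OF _ \<phi> assms]) (simp add: \<Sigma>\<^sub>A_def)
qed

lemma good_singleton: "w \<in> Omega A \<Longrightarrow> good \<Sigma>\<^sub>A A p {w p}"
  unfolding good_def using provable_\<Sigma>\<^sub>A_refl by blast

lemma good_smul:
  assumes "p \<in> tests A" "good \<Sigma>\<^sub>A A p X" "good \<Sigma>\<^sub>A A p Y"
  shows "good \<Sigma>\<^sub>A A p (smul (fst p) X Y)"
proof -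
  obtain g where g: "g \<in> Omega A" "\<forall>t\<in>X. \<exists>w. (w, g) \<in> provable \<Sigma>\<^sub>A A \<and> w p = t"
    using assms(2) unfolding good_def by blast
  obtain h where h: "h \<in> Omega A" "\<forall>t\<in>Y. \<exists>w. (w, h) \<in> provable \<Sigma>\<^sub>A A \<and> w p = t"
    using assms(3) unfolding good_def by blast
  have "\<exists>w. (w, om_mul A g h) \<in> provable \<Sigma>\<^sub>A A \<and> w p = t" if st: "t \<in> smul (fst p) X Y" for t
  proof -
    obtain x y where t: "x \<in> X" "y \<in> Y" "t = fm_mul (fst p) x y" using st unfolding smul_def by blast
    obtain v where v: "(v, g) \<in> provable \<Sigma>\<^sub>A A" "v p = x" using g(2) t(1) by blast
    obtain w where w: "(w, h) \<in> provable \<Sigma>\<^sub>A A" "w p = y" using h(2) t(2) by blast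
    show ?thesis
      using provable_mul[OF pseudoidentity_\<Sigma>\<^sub>A v(1) w(1)] v(2) w(2) t(3) om_mul_apply[OF assms(1), of v w] by blast
  qed
  then show ?thesis unfolding good_def using g(1) h(1) by (intro bexI[of _ "om_mul A g h"]) auto
qed

text \<open>Factorials are used as exponents because \<open>X\<^sup>n\<close> is stationary along them, so an element of the
  stationary value has witnesses provably equal to \<open>g\<^sup>n\<^sup>!\<close> for all large \<open>n\<close>, hence by compactness
  one provably equal to \<open>g\<^sup>\<omega>\<close>.\<close>

lemma good_cover:
  assumes p: "(T, f) \<in> tests A" and X: "X \<subseteq> fm_car T" and good: "good \<Sigma>\<^sub>A A (T, f) X"
  shows "\<exists>Y n. Y \<subseteq> fm_car T \<and> good \<Sigma>\<^sub>A A (T, f) Y \<and>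
    (rmul T X ^^ n) {fm_one T} \<subseteq> Y \<and> (rmul T X ^^ Suc n) {fm_one T} \<subseteq> Y"
proof -
  let ?\<rho> = "provable \<Sigma>\<^sub>A A"
  note T = testsD(1)[OF p]
  define P where "P n = (rmul T X ^^ n) {fm_one T}" for n
  have P_sub: "P n \<subseteq> fm_car T" for n using rmul_funpow[OF T X, of n] by (simp add: P_def)
  have P_Suc: "P (Suc n) = smul T (P n) X" for n
    using P_sub[of n] unfolding P_def by (simp add: rmul_def)
  obtain g where g: "g \<in> Omega A" "\<forall>t\<in>X. \<exists>w. (w, g) \<in> ?\<rho> \<and> w (T, f) = t"
    using good unfolding good_def by blast
  have mul: "\<exists>w. (w, om_mul A h g) \<in> ?\<rho> \<and> w (T, f) = t"
    if h: "\<forall>t\<in>Y. \<exists>w. (w, h) \<in> ?\<rho> \<and> w (T, f) = t" and t: "t \<in> smul T Y X" for h Y t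
  proof -
    obtain y x where t: "y \<in> Y" "x \<in> X" "t = fm_mul T y x" using t unfolding smul_def by blast
    obtain v where v: "(v, h) \<in> ?\<rho>" "v (T, f) = y" using h t(1) by blast
    obtain w where w: "(w, g) \<in> ?\<rho>" "w (T, f) = x" using g(2) t(2) by blast
    show ?thesis
      using provable_mul[OF pseudoidentity_\<Sigma>\<^sub>A v(1) w(1)] v(2) w(2) t(3) om_mul_apply[OF p, of v w] by auto
  qed
  have P_wit: "\<forall>t\<in>P n. \<exists>w. (w, om_pow A g n) \<in> ?\<rho> \<and> w (T, f) = t" for n
  proof (induction n)
    case 0
    then show ?case
      using provable_\<Sigma>\<^sub>A_refl[OF om_one_in] om_one_apply[OF p] by (auto simp: P_def om_pow_def)
  next
    case (Suc n)
    show ?case unfolding P_Suc om_pow_Suc_right[OF g(1), symmetric] using mul[OF Suc] by blast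
  qed
  have "rmul T X \<in> Pow (fm_car T) \<rightarrow> Pow (fm_car T)"
    using smul_subset[OF T _ X] by (auto simp: rmul_def)
  then obtain N where N: "\<And>n Z. n \<ge> N \<Longrightarrow> Z \<in> Pow (fm_car T) \<Longrightarrow>
      (rmul T X ^^ fact n) Z = (rmul T X ^^ fact N) Z"
    using funpow_fact_eventually[of "Pow (fm_car T)"] finite_fm_car[of T] by (metis finite_Pow_iff)
  have PN: "P (fact n) = P (fact N)" if "n \<ge> N" for n
    unfolding P_def using that fm_one_in[OF T] by (intro N) simp_all
  have wit: "\<forall>t\<in>P (fact N). \<exists>w. (w, om_omega A g) \<in> ?\<rho> \<and> w (T, f) = t"
  proof
    fix t assume t: "t \<in> P (fact N)"
    let ?Z = "{h. \<exists>w. (w, h) \<in> ?\<rho> \<and> w (T, f) = t}"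
    have "closedin (OmTop A) ?Z"
      by (rule closedin_fibre_image[OF closedin_provable[OF pseudoidentity_\<Sigma>\<^sub>A] p])
    moreover have "\<forall>\<^sub>F n in sequentially. om_pow A g (fact n) \<in> ?Z"
      unfolding eventually_sequentially
    proof (intro exI allI impI)
      fix n assume "N \<le> n"
      from PN[OF this] have "t \<in> P (fact n)" using t by simp
      then show "om_pow A g (fact n) \<in> ?Z" using P_wit[of "fact n"] by blast
    qed
    ultimately have "om_omega A g \<in> ?Z"
      by (rule limitin_closedin[OF limitin_om_omega[OF g(1)]]) simp
    then show "\<exists>w. (w, om_omega A g) \<in> ?\<rho> \<and> w (T, f) = t" by simp
  qed
  \<comment> \<open>One more factor from \<open>X\<close> moves the anchor to
    \<open>g\<^sup>\<omega>g\<close>, and the pseudoidentity brings it back to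
    \<open>g\<^sup>\<omega>\<close>. Both powers thereby share one anchor, which is what makes their
    union good.\<close>
  have wit': "\<forall>t\<in>P (Suc (fact N)). \<exists>w. (w, om_omega A g) \<in> ?\<rho> \<and> w (T, f) = t"
    unfolding P_Suc
  proof
    fix t assume "t \<in> smul T (P (fact N)) X"
    from mul[OF wit this] obtain w where "(w, om_mul A (om_omega A g) g) \<in> ?\<rho>" "w (T, f) = t" by blast
    then show "\<exists>w. (w, om_omega A g) \<in> ?\<rho> \<and> w (T, f) = t"
      using provable.trans[OF _ provable_omega[OF g(1)]] by blast
  qed
  let ?Y = "P (fact N) \<union> P (Suc (fact N))"
  have "good \<Sigma>\<^sub>A A (T, f) ?Y"
    unfolding good_def using wit wit' om_omega_in[OF g(1)] by blast
  then have "?Y \<subseteq> fm_car T \<and> good \<Sigma>\<^sub>A A (T, f) ?Y \<and> P (fact N) \<subseteq> ?Y \<and> P (Suc (fact N)) \<subseteq> ?Y"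
    using P_sub by blast
  then show ?thesis unfolding P_def by (intro exI)
qed

text \<open>The order is inclusion of subsets. The covering condition need only be checked at the
  singleton of the unit, because every iterate of \<open>rmul T X\<close> is itself right
  multiplication by its value there.\<close>

lemma covering_action_good:
  assumes p: "(T, f) \<in> tests A"
  shows "covering_action (Pow (fm_car T)) {rmul T X | X. X \<subseteq> fm_car T \<and> good \<Sigma>\<^sub>A A (T, f) X}"
    (is "covering_action ?Q ?S")
proof
  note T = testsD(1)[OF p]
  show "finite ?Q" by simp
  have "good \<Sigma>\<^sub>A A (T, f) {fm_one T}"
    using good_singleton[OF om_one_in, of A "(T, f)"] om_one_apply[OF p] by simp
  then show "id \<in> ?S" using rmul_one[OF T] fm_one_in[OF T] by force
  show "s \<circ> t \<in> ?S" if st: "s \<in> ?S" "t \<in> ?S" for s t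
  proof -
    obtain X Y where X: "X \<subseteq> fm_car T" "good \<Sigma>\<^sub>A A (T, f) X" "s = rmul T X"
      and Y: "Y \<subseteq> fm_car T" "good \<Sigma>\<^sub>A A (T, f) Y" "t = rmul T Y" using st by blast
    have "s \<circ> t = rmul T (smul T Y X)" using rmul_comp[OF T X(1) Y(1)] X(3) Y(3) by simp
    then show ?thesis using smul_subset[OF T Y(1) X(1)] good_smul[OF p Y(2) X(2)] by auto
  qed
  show "s q \<in> ?Q" if sq: "s \<in> ?S" "q \<in> ?Q" for s q
  proof -
    obtain X where "X \<subseteq> fm_car T" "s = rmul T X" using sq(1) by blast
    then show ?thesis using smul_subset[OF T, of q X] sq(2) by (simp add: rmul_def)
  qed
  show "s q \<le> s q'" if sq: "s \<in> ?S" "q \<in> ?Q" "q' \<in> ?Q" "q \<le> q'" for s q q'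
  proof -
    obtain X where "s = rmul T X" using sq(1) by blast
    then show ?thesis using smul_mono[OF sq(4) order_refl, of T X] sq(2,3) by (simp add: rmul_def)
  qed
  show "\<exists>y\<in>?S. \<exists>n. \<forall>q\<in>?Q. (s ^^ n) q \<le> y q \<and> (s ^^ Suc n) q \<le> y q" if s: "s \<in> ?S" for s
  proof -
    obtain X where X: "X \<subseteq> fm_car T" "good \<Sigma>\<^sub>A A (T, f) X" "s = rmul T X" using s by blast
    obtain Y n where Y: "Y \<subseteq> fm_car T" "good \<Sigma>\<^sub>A A (T, f) Y"
      "(s ^^ n) {fm_one T} \<subseteq> Y" "(s ^^ Suc n) {fm_one T} \<subseteq> Y"
      using good_cover[OF p X(1,2)] unfolding X(3) by blast
    have le: "(s ^^ m) q \<le> rmul T Y q" if "(s ^^ m) {fm_one T} \<subseteq> Y" "q \<in> ?Q" for m q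
    proof -
      have "(s ^^ m) q = rmul T ((s ^^ m) {fm_one T}) q"
        using rmul_funpow[OF T X(1), of m] unfolding X(3) by metis
      then show ?thesis using smul_mono[OF order_refl that(1), of T q] that(2) by (simp add: rmul_def)
    qed
    show ?thesis
      using Y(1,2) le[OF Y(3)] le[OF Y(4)] by (intro bexI[of _ "rmul T Y"] exI[of _ n]) blast+
  qed
qed

text \<open>Right multiplication reads a word from left to right, as \<open>fold\<close> does;
  started at the unit, the action computes the value of the word.\<close>

lemma fold_rmul_word:
  assumes p: "(T, f) \<in> tests A" and w: "w \<in> lists A" and x: "x \<in> fm_car T"
  shows "fold (\<lambda>s. s) (map (\<lambda>a. rmul T {f a}) w) {x} = {fm_mul T x (wev T f w)}"
  using w x
proof (induction w arbitrary: x rule: list.induct)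
  case Nil
  then show ?case using fm_one_right[OF testsD(1)[OF p]] by simp
next
  case (Cons a w)
  note T = testsD(1)[OF p]
  have a: "f a \<in> fm_car T" "w \<in> lists A" using Cons.prems(1) tests_app[OF p] by auto
  have "rmul T {f a} {x} = {fm_mul T x (f a)}" using Cons.prems(2) by (simp add: rmul_def smul_def)
  then show ?case
    using Cons.IH[OF a(2) fm_mul_in[OF T Cons.prems(2) a(1)]]
      fm_assoc[OF T Cons.prems(2) a(1) wev_in[OF p a(2)]] by simp
qed

text \<open>Words with the same class have the same colour \<open>rmul T X\<close>. Applied to the
  singleton of the unit, this bound shows that \<open>X\<close> contains both values, and the common
  anchor of \<open>X\<close> links their witnesses by transitivity and symmetry.\<close>

lemma aperiodic_test:
  assumes A: "finite A" and p: "(T, f) \<in> tests A"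
  shows "\<exists>N h. (N, h) \<in> tests A \<and> N \<in> models \<Sigma>\<^sub>A \<and>
    (\<forall>w\<in>lists A. \<forall>w'\<in>lists A. wev N h w = wev N h w' \<longrightarrow>
      (\<exists>u v. (u, v) \<in> provable \<Sigma>\<^sub>A A \<and> u (T, f) = wev T f w \<and> v (T, f) = wev T f w'))"
proof -
  note T = testsD(1)[OF p]
  let ?r = "\<lambda>a. rmul T {f a}" and ?S = "{rmul T X | X. X \<subseteq> fm_car T \<and> good \<Sigma>\<^sub>A A (T, f) X}"
  let ?A = "?r ` A"
  have "?A \<subseteq> ?S"
  proof
    fix s assume "s \<in> ?A"
    then obtain a where a: "a \<in> A" "s = rmul T {f a}" by blast
    have "good \<Sigma>\<^sub>A A (T, f) {f a}"
      using good_singleton[OF om_gen_in[OF a(1)], of "(T, f)"] p by (simp add: om_gen_def)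
    then show "s \<in> ?S" using a tests_app[OF p a(1)] by auto
  qed
  then have "\<exists>F. (\<forall>w\<in>lists ?A. F w \<in> ?S \<and> (\<forall>q\<in>Pow (fm_car T). fold (\<lambda>s. s) w q \<le> F w q)) \<and> aperiodic_on ?A F"
    using A by (intro aperiodic_cover covering_action_good[OF p]) simp_all
  then obtain F where F: "\<forall>w\<in>lists ?A. F w \<in> ?S \<and> (\<forall>q\<in>Pow (fm_car T). fold (\<lambda>s. s) w q \<le> F w q)"
    and ap: "aperiodic_on ?A F" by blast
  have map_in: "map ?r w \<in> lists ?A" if "w \<in> lists A" for w
    using that by (auto simp: in_lists_conv_set)
  \<comment> \<open>The colouring lives on words of actions, and distinct letters may act equally,
    so its classes are pulled back along the letters.\<close>
  define K where "K w = syn ?A F (map ?r w)" for w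
  have "K ` lists A \<subseteq> syn ?A F ` lists ?A" unfolding K_def using map_in by blast
  then have "finite (K ` lists A)"
    by (rule finite_subset) (use ap in \<open>simp add: aperiodic_on_def\<close>)
  moreover have "\<forall>w\<in>lists A. \<forall>w'\<in>lists A. \<forall>u\<in>lists A. \<forall>v\<in>lists A. K w = K w' \<longrightarrow> K (u @ w @ v) = K (u @ w' @ v)"
    unfolding K_def map_append by (intro ballI impI syn_cong map_in)
  ultimately have "\<exists>N h. (N, h) \<in> tests A \<and> fm_car N = wev N h ` lists A \<and>
    (\<forall>w\<in>lists A. \<forall>w'\<in>lists A. wev N h w = wev N h w' \<longleftrightarrow> K w = K w')"
    by (rule word_quotient)
  then obtain N h where N: "(N, h) \<in> tests A" "fm_car N = wev N h ` lists A"
    and eq: "\<forall>w\<in>lists A. \<forall>w'\<in>lists A. wev N h w = wev N h w' \<longleftrightarrow> K w = K w'" by blast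
  obtain n where n: "\<forall>m\<ge>n. \<forall>x\<in>lists ?A. syn ?A F (wpow m x) = syn ?A F (wpow (Suc m) x)"
    using ap unfolding aperiodic_on_def by blast
  have "\<exists>n. \<forall>m\<ge>n. fm_pow N x m = fm_pow N x (Suc m)" if x: "x \<in> fm_car N" for x
  proof (intro exI allI impI)
    fix m assume m: "n \<le> m"
    obtain w where w: "w \<in> lists A" "x = wev N h w" using x N(2) by blast
    have "K (wpow m w) = K (wpow (Suc m) w)"
      unfolding K_def map_wpow using n m map_in[OF w(1)] by blast
    then have "wev N h (wpow m w) = wev N h (wpow (Suc m) w)"
      using eq wpow_in_lists[OF w(1)] by blast
    then show "fm_pow N x m = fm_pow N x (Suc m)"
      unfolding wev_wpow[OF N(1) w(1)] w(2) .
  qed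
  then have "N \<in> models \<Sigma>\<^sub>A"
    unfolding models_def \<Sigma>\<^sub>A_def
    using aperiodic_holds_in[OF testsD(1)[OF N(1)] _ om_gen_in[of 0 "{0}"]] testsD(1)[OF N(1)] by simp
  moreover have "\<exists>u v. (u, v) \<in> provable \<Sigma>\<^sub>A A \<and> u (T, f) = wev T f w \<and> v (T, f) = wev T f w'"
    if w: "w \<in> lists A" "w' \<in> lists A" and ww: "wev N h w = wev N h w'" for w w'
  proof -
    have Fw: "F (map ?r w) = F (map ?r w')"
      using eq w ww syn_imp_eq unfolding K_def by blast
    obtain X where X: "X \<subseteq> fm_car T" "good \<Sigma>\<^sub>A A (T, f) X" "F (map ?r w) = rmul T X"
      using F map_in[OF w(1)] by blast
    have mem: "wev T f v \<in> X" if v: "v \<in> lists A" "F (map ?r v) = rmul T X" for v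
    proof -
      have "fold (\<lambda>s. s) (map ?r v) {fm_one T} \<subseteq> rmul T X {fm_one T}"
        using F map_in[OF v(1)] v(2) fm_one_in[OF T] by fastforce
      then show ?thesis
        using fold_rmul_word[OF p v(1) fm_one_in[OF T]] fm_one_left[OF T wev_in[OF p v(1)]]
          smul_one(2)[OF T X(1)] fm_one_in[OF T] by (simp add: rmul_def)
    qed
    obtain g where g: "\<forall>t\<in>X. \<exists>w. (w, g) \<in> provable \<Sigma>\<^sub>A A \<and> w (T, f) = t"
      using X(2) unfolding good_def by blast
    obtain u where u: "(u, g) \<in> provable \<Sigma>\<^sub>A A" "u (T, f) = wev T f w"
      using g mem[OF w(1) X(3)] by blast
    obtain v where v: "(v, g) \<in> provable \<Sigma>\<^sub>A A" "v (T, f) = wev T f w'"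
      using g mem[OF w(2)] X(3) Fw by force
    show ?thesis using provable.trans[OF u(1) provable_sym[OF v(1)]] u(2) v(2) by blast
  qed
  ultimately show ?thesis using N(1) by blast
qed

lemma joint_test_separates:
  assumes "finite I" "I \<subseteq> tests B"
  shows "\<exists>p\<in>tests B. \<forall>u\<in>Omega B. \<forall>v\<in>Omega B. u p = v p \<longrightarrow> (\<forall>q\<in>I. u q = v q)"
proof -
  obtain N f where N: "(N, f) \<in> tests B" "fm_car N = wev N f ` lists B" and
    I: "\<forall>u\<in>Omega B. \<forall>w\<in>lists B. u (N, f) = wev N f w \<longrightarrow> (\<forall>T g. (T, g) \<in> I \<longrightarrow> u (T, g) = wev T g w)"
    using joint_test[OF assms] by blast
  have "u q = v q" if uv: "u \<in> Omega B" "v \<in> Omega B" "u (N, f) = v (N, f)" and q: "q \<in> I" for u v q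
  proof -
    obtain w where w: "w \<in> lists B" "u (N, f) = wev N f w"
      using Omega_in[OF uv(1) N(1)] N(2) by blast
    obtain T g where "q = (T, g)" by fastforce
    then show ?thesis using I uv w q by metis
  qed
  then show ?thesis using N(1) by blast
qed

theorem theorem7p3:
  shows "h_strong {({0}, om_omega_plus1 {0} (om_gen {0} 0), om_omega {0} (om_gen {0} 0))}"
  unfolding \<Sigma>\<^sub>A_def[symmetric] h_strong_def
proof (intro allI impI, elim conjE)
  fix B u v
  assume "pseudoidentity (B, u, v)" and hold: "\<forall>T\<in>models \<Sigma>\<^sub>A. holds_in T (B, u, v)"
  then have B: "finite B" and u: "u \<in> Omega B" and v: "v \<in> Omega B"
    by (simp_all add: pseudoidentity_def)
  let ?\<rho> = "provable \<Sigma>\<^sub>A B"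
  have "(u, v) \<in> prod_topology (OmTop B) (OmTop B) closure_of ?\<rho>"
    unfolding in_closure_of
  proof (intro conjI allI impI)
    show "(u, v) \<in> topspace (prod_topology (OmTop B) (OmTop B))" using u v by simp
    fix W assume "(u, v) \<in> W \<and> openin (prod_topology (OmTop B) (OmTop B)) W"
    then obtain U V where U: "openin (OmTop B) U" "u \<in> U" and V: "openin (OmTop B) V" "v \<in> V" and W: "U \<times> V \<subseteq> W"
      unfolding openin_prod_topology_alt by blast
    obtain I where I: "finite I" "I \<subseteq> tests B" "\<forall>x\<in>Omega B. (\<forall>p\<in>I. x p = u p) \<longrightarrow> x \<in> U"
      by (rule openin_OmTop_basic[OF U])
    obtain J where J: "finite J" "J \<subseteq> tests B" "\<forall>x\<in>Omega B. (\<forall>p\<in>J. x p = v p) \<longrightarrow> x \<in> V"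
      by (rule openin_OmTop_basic[OF V])
    have "finite (I \<union> J)" "I \<union> J \<subseteq> tests B" using I(1,2) J(1,2) by auto
    \<comment> \<open>Agreement with \<open>u\<close> or \<open>v\<close> at this single test is
      enough to enter \<open>U\<close> or \<open>V\<close>, so good sets are needed in one monoid
      only.\<close>
    from joint_test_separates[OF this] obtain T f where p: "(T, f) \<in> tests B"
      and sep: "\<forall>x\<in>Omega B. \<forall>y\<in>Omega B. x (T, f) = y (T, f) \<longrightarrow> (\<forall>q\<in>I \<union> J. x q = y q)" by fast
    obtain N h where N: "(N, h) \<in> tests B" "N \<in> models \<Sigma>\<^sub>A" and
      lift: "\<forall>w\<in>lists B. \<forall>w'\<in>lists B. wev N h w = wev N h w' \<longrightarrow>
        (\<exists>x y. (x, y) \<in> ?\<rho> \<and> x (T, f) = wev T f w \<and> y (T, f) = wev T f w')"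
      using aperiodic_test[OF B p] by blast
    have "holds_in N (B, u, v)" using hold N(2) by (rule bspec)
    then have "\<forall>\<psi>. cont_hom_fm B N \<psi> \<longrightarrow> \<psi> u = \<psi> v" unfolding holds_in_def prod.case .
    from mp[OF spec[OF this, of "\<lambda>x. x (N, h)"] cont_hom_fm_eval[OF N(1)]]
    have uv: "u (N, h) = v (N, h)" .
    \<comment> \<open>The same word must represent \<open>u\<close> in both monoids: equality in
      \<open>N\<close> triggers the lifting, while the lifted pair is located by its values in
      \<open>T\<close>. The same holds for \<open>v\<close>.\<close>
    have fin: "finite {(T, f), (N, h)}" "{(T, f), (N, h)} \<subseteq> tests B" using p N(1) by auto
    obtain w where w: "w \<in> lists B" "\<forall>S g. (S, g) \<in> {(T, f), (N, h)} \<longrightarrow> u (S, g) = wev S g w"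
      by (rule words_dense[OF fin u])
    obtain w' where w': "w' \<in> lists B" "\<forall>S g. (S, g) \<in> {(T, f), (N, h)} \<longrightarrow> v (S, g) = wev S g w'"
      by (rule words_dense[OF fin v])
    have "wev N h w = wev N h w'" using uv w(2)[rule_format, of N h] w'(2)[rule_format, of N h] by simp
    then obtain x y where xy: "(x, y) \<in> ?\<rho>" "x (T, f) = wev T f w" "y (T, f) = wev T f w'"
      using lift w(1) w'(1) by blast
    have in_Omega: "x \<in> Omega B" "y \<in> Omega B"
      using provable_subset[OF pseudoidentity_\<Sigma>\<^sub>A] xy(1) by auto
    have "x (T, f) = u (T, f)" "y (T, f) = v (T, f)" using xy(2,3) w(2)[rule_format, of T f] w'(2)[rule_format, of T f] by simp_all
    then have "x q = u q" "y q = v q" if "q \<in> I \<union> J" for q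
      using sep in_Omega u v that by blast+
    then have "x \<in> U" "y \<in> V" using I(3) J(3) in_Omega by blast+
    then show "\<exists>q. q \<in> ?\<rho> \<and> q \<in> W" using xy(1) W by blast
  qed
  then show "(u, v) \<in> ?\<rho>" by (rule provable.closure)
qed

end
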